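(* Let $G=(V,E)$ be a finite connected graph and $o\in V$ a fixed vertex. Then there is an $N\ge 0$ such that for Bernoulli percolation on the layered graph $G^\times$ we have $$\forall n\ge N\ \ \forall p\in(0,1)\ \ \forall x\in M^*:\quad \mathbb{P}_p(\mathcal{X}_n=x)\ \ge\ \mathbb{P}_p(\mathcal{X}_{n+1}=x).$$ In particular, for all $n\ge N$, $p\in[0,1]$ and $v\in V$ we have $$\mathbb{P}_p((o,0)\leftrightarrow(v,n))\ge \mathbb{P}_p((o,0)\leftrightarrow(v,n+1))\quad\text{and}\quad \mathbb{E}_p(\mathcal{W}_n)\ge\mathbb{E}_p(\mathcal{W}_{n+1}).$$
   Context: Graphs are simple. The layered graph $G^\times$ is the Cartesian product of $G=(V,E)$ and $\mathbb{Z}$: its vertex set is $V\times\mathbb{Z}$; its edges are the horizontal edges $(u,l)(v,l)$ with $uv\in E$, $l\in\mathbb{Z}$, and the vertical edges $(u,l-1)(u,l)$ with $u\in V$, $l\in\mathbb{Z}$. For $n\in\mathbb{Z}$ let $V_n=V\times\{n\}$, $E_n^h=\{(u,n)(v,n):uv\in E\}$, $E_n^v=\{(u,n-1)(u,n):u\in V\}$, $E_n=E_n^h\cup E_n^v$, and $E_{..n}=\bigcup_{m\le n}E_m$. Bernoulli (bond) percolation with parameter $p$: independent random variables $\mathcal{Z}_e$, $e\in E(G^\times)$, with $\mathbb{P}_p(\mathcal{Z}_e=1)=p$ (open) and $\mathbb{P}_p(\mathcal{Z}_e=0)=1-p$ (closed); $\mathbb{E}_p$ is the corresponding expectation. $u'\leftrightarrow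 v'$ means that there is a path of open edges from $u'$ to $v'$. $u'\leftrightarrow_{\le n}v'$ means there is such a path using only open edges from $E_{..n}$. Let $*\notin V$ be an abstract symbol. A pattern is a partition $x$ of $V\cup\{*\}$; $\sim_x$ is the corresponding equivalence relation. $M$ is the set of all patterns and $M^*=\{x\in M:\exists u\in V: u\sim_x *\}$. For $n\ge0$, $\mathcal{X}_n$ is the random pattern defined by $\mathcal{X}_n=x$ iff for all $u,v\in V$: $u\sim_x v\Leftrightarrow (u,n)\leftrightarrow_{\le n}(v,n)$, and for all $u\in V$: $u\sim_x *\Leftrightarrow (u,n)\leftrightarrow_{\le n}(o,0)$. Also $\mathcal{W}_n=|\{v'\in V_n: v'\leftrightarrow (o,0)\}|$. *)

theory Defs
  imports "HOL-Probability.Probability"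
begin

text \<open>Undirected graphs are given by a vertex set and a set of edges, an edge being the set of
  its two end vertices.\<close>

definition simple_graph :: "'v set \<Rightarrow> 'v set set \<Rightarrow> bool" where
  "simple_graph V E \<longleftrightarrow> (\<forall>e\<in>E. \<exists>u\<in>V. \<exists>v\<in>V. u \<noteq> v \<and> e = {u, v})"

definition graph_path :: "'v set set \<Rightarrow> 'v list \<Rightarrow> bool" where
  "graph_path F xs \<longleftrightarrow> xs \<noteq> [] \<and> distinct xs \<and> successively (\<lambda>u v. {u, v} \<in> F) xs"

definition joined :: "'v set set \<Rightarrow> 'v \<Rightarrow> 'v \<Rightarrow> bool" where
  "joined F u v \<longleftrightarrow> (\<exists>xs. graph_path F xs \<and> hd xs = u \<and> last xs = v)"

definition connected_graph :: "'v set \<Rightarrow> 'v set set \<Rightarrow> bool" where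
  "connected_graph V E \<longleftrightarrow> V \<noteq> {} \<and> (\<forall>u\<in>V. \<forall>v\<in>V. joined E u v)"

lemma joined_iff_rtranclp: "joined F u v \<longleftrightarrow> (\<lambda>a b. {a, b} \<in> F)\<^sup>*\<^sup>* u v"
proof
  assume "joined F u v"
  then obtain xs where "xs \<noteq> []" "successively (\<lambda>a b. {a, b} \<in> F) xs" "hd xs = u" "last xs = v"
    by (auto simp: joined_def graph_path_def)
  then show "(\<lambda>a b. {a, b} \<in> F)\<^sup>*\<^sup>* u v"
  proof (induction xs arbitrary: u rule: list_nonempty_induct)
    case (single x)
    then show ?case by simp
  next
    case (cons x xs)
    then have "{u, hd xs} \<in> F" "(\<lambda>a b. {a, b} \<in> F)\<^sup>*\<^sup>* (hd xs) v"
      by (auto simp: successively_Cons)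
    then show ?case
      by (rule converse_rtranclp_into_rtranclp)
  qed
next
  assume "(\<lambda>a b. {a, b} \<in> F)\<^sup>*\<^sup>* u v"
  then show "joined F u v"
  proof (induction rule: converse_rtranclp_induct)
    case base
    have "graph_path F [v]" by (simp add: graph_path_def)
    then show ?case unfolding joined_def by (intro exI[of _ "[v]"]) simp
  next
    case (step a b)
    then obtain xs where xs: "graph_path F xs" "hd xs = b" "last xs = v"
      by (auto simp: joined_def)
    show ?case
    proof (cases "a \<in> set xs")
      case True
      then obtain ys zs where "xs = ys @ a # zs" by (auto simp: in_set_conv_decomp)
      then have "graph_path F (a # zs)" "last (a # zs) = v"
        using xs by (auto simp: graph_path_def successively_append_iff)
      then show ?thesis unfolding joined_def by (intro exI[of _ "a # zs"]) simp
    next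
      case False
      then have "graph_path F (a # xs)" "last (a # xs) = v"
        using xs step.hyps by (auto simp: graph_path_def successively_Cons)
      then show ?thesis unfolding joined_def by (intro exI[of _ "a # xs"]) simp
    qed
  qed
qed

lemma joined_refl: "joined F u u"
  by (simp add: joined_iff_rtranclp)

lemma joined_sym: "joined F u v \<Longrightarrow> joined F v u"
proof -
  have "symp (\<lambda>a b. {a, b} \<in> F)" by (simp add: symp_def insert_commute)
  then have "symp (\<lambda>a b. {a, b} \<in> F)\<^sup>*\<^sup>*" by (rule symp_rtranclp)
  then show "joined F u v \<Longrightarrow> joined F v u" by (auto simp: joined_iff_rtranclp dest: sympD)
qed

lemma joined_trans: "joined F u v \<Longrightarrow> joined F v w \<Longrightarrow> joined F u w"
  by (auto simp: joined_iff_rtranclp)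

definition horizontal_edges :: "'a set set \<Rightarrow> int \<Rightarrow> ('a \<times> int) set set" where
  "horizontal_edges E n = {{(u, n), (v, n)} | u v. {u, v} \<in> E}"

definition vertical_edges :: "'a set \<Rightarrow> int \<Rightarrow> ('a \<times> int) set set" where
  "vertical_edges V n = {{(u, n - 1), (u, n)} | u. u \<in> V}"

definition layer_edges :: "'a set \<Rightarrow> 'a set set \<Rightarrow> int \<Rightarrow> ('a \<times> int) set set" where
  "layer_edges V E n = horizontal_edges E n \<union> vertical_edges V n"

definition edges_upto :: "'a set \<Rightarrow> 'a set set \<Rightarrow> int \<Rightarrow> ('a \<times> int) set set" where
  "edges_upto V E n = (\<Union>m\<in>{..n}. layer_edges V E m)"

definition layered_edges :: "'a set \<Rightarrow> 'a set set \<Rightarrow> ('a \<times> int) set set" where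
  "layered_edges V E = (\<Union>n. layer_edges V E n)"

text \<open>The canonical model: a configuration \<open>\<omega>\<close> maps each edge of the layered graph to
  \<^term>\<open>True\<close> (open) or \<^term>\<open>False\<close> (closed), and the edge states are independent.\<close>

definition percolation ::
  "'a set \<Rightarrow> 'a set set \<Rightarrow> real \<Rightarrow> (('a \<times> int) set \<Rightarrow> bool) measure" where
  "percolation V E p = (\<Pi>\<^sub>M e\<in>layered_edges V E. measure_pmf (bernoulli_pmf p))"

definition conn ::
  "'a set \<Rightarrow> 'a set set \<Rightarrow> (('a \<times> int) set \<Rightarrow> bool) \<Rightarrow> 'a \<times> int \<Rightarrow> 'a \<times> int \<Rightarrow> bool" where
  "conn V E \<omega> = joined {e \<in> layered_edges V E. \<omega> e}"

definition conn_upto ::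
  "'a set \<Rightarrow> 'a set set \<Rightarrow> int \<Rightarrow> (('a \<times> int) set \<Rightarrow> bool) \<Rightarrow> 'a \<times> int \<Rightarrow> 'a \<times> int \<Rightarrow> bool" where
  "conn_upto V E n \<omega> = joined {e \<in> edges_upto V E n. \<omega> e}"

text \<open>The vertex \<open>u\<close> is represented by \<^term>\<open>Some u\<close>, the additional symbol \<open>*\<close> by
  \<^term>\<open>None\<close>.\<close>

definition patterns :: "'a set \<Rightarrow> 'a option set set set" where
  "patterns V = {x. partition_on (insert None (Some ` V)) x}"

definition pattern_rel :: "'b set set \<Rightarrow> 'b \<Rightarrow> 'b \<Rightarrow> bool" where
  "pattern_rel x a b \<longleftrightarrow> (\<exists>B\<in>x. a \<in> B \<and> b \<in> B)"

definition star_patterns :: "'a set \<Rightarrow> 'a option set set set" where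
  "star_patterns V = {x \<in> patterns V. \<exists>u\<in>V. pattern_rel x (Some u) None}"

definition induces_pattern ::
  "'a set \<Rightarrow> 'a set set \<Rightarrow> 'a \<Rightarrow> int \<Rightarrow> (('a \<times> int) set \<Rightarrow> bool) \<Rightarrow> 'a option set set \<Rightarrow> bool" where
  "induces_pattern V E r n \<omega> x \<longleftrightarrow> x \<in> patterns V \<and>
     (\<forall>u\<in>V. \<forall>v\<in>V. pattern_rel x (Some u) (Some v) \<longleftrightarrow> conn_upto V E n \<omega> (u, n) (v, n)) \<and>
     (\<forall>u\<in>V. pattern_rel x (Some u) None \<longleftrightarrow> conn_upto V E n \<omega> (u, n) (r, 0))"

definition layer_pattern ::
  "'a set \<Rightarrow> 'a set set \<Rightarrow> 'a \<Rightarrow> int \<Rightarrow> (('a \<times> int) set \<Rightarrow> bool) \<Rightarrow> 'a option set set" where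
  "layer_pattern V E r n \<omega> = (THE x. induces_pattern V E r n \<omega> x)"

lemma pattern_eqI:
  assumes "partition_on A x" "partition_on A y"
    and rel: "\<And>a b. a \<in> A \<Longrightarrow> b \<in> A \<Longrightarrow> pattern_rel x a b \<longleftrightarrow> pattern_rel y a b"
  shows "x = y"
proof -
  have quot: "z = A // {(a, b). pattern_rel z a b}" if "partition_on A z" for z
    using partition_on_eq_quotient[OF that] by (simp add: pattern_rel_def)
  have dom: "a \<in> A \<and> b \<in> A" if "partition_on A z" "pattern_rel z a b" for z a b
    using that by (auto simp: pattern_rel_def partition_on_def)
  have "pattern_rel x = pattern_rel y"
    using rel dom assms(1,2) by (intro ext) blast
  then show ?thesis
    using quot[OF assms(1)] quot[OF assms(2)] by simp
qed

lemma ex1_induces_pattern: "\<exists>!x. induces_pattern V E r n \<omega> x"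
proof -
  define A where "A = insert None (Some ` V)"
  define f where "f = (\<lambda>a. case a of None \<Rightarrow> (r, 0) | Some u \<Rightarrow> (u, n))"
  define R where "R = {(a, b). a \<in> A \<and> b \<in> A \<and> conn_upto V E n \<omega> (f a) (f b)}"
  have "equiv A R"
    unfolding R_def conn_upto_def
    by (intro equivI refl_onI symI transI) (auto intro: joined_refl joined_sym joined_trans)
  have part: "partition_on A (A // R)"
    using \<open>equiv A R\<close> by (rule partition_on_quotient)
  have rel: "pattern_rel (A // R) a b \<longleftrightarrow> (a, b) \<in> R" if "a \<in> A" "b \<in> A" for a b
  proof
    assume "pattern_rel (A // R) a b"
    then show "(a, b) \<in> R"
      using quotient_eq_iff[OF \<open>equiv A R\<close>] by (auto simp: pattern_rel_def)
  next
    assume "(a, b) \<in> R"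
    then show "pattern_rel (A // R) a b"
      using that equiv_class_self[OF \<open>equiv A R\<close>]
      by (auto simp: pattern_rel_def intro!: bexI[of _ "R `` {a}"] quotientI)
  qed
  have ex: "induces_pattern V E r n \<omega> (A // R)"
    using part rel unfolding induces_pattern_def patterns_def
    by (auto simp: A_def R_def f_def)
  moreover have "x = A // R" if x: "induces_pattern V E r n \<omega> x" for x
  proof (rule pattern_eqI[OF _ part])
    show px: "partition_on A x"
      using x by (simp add: induces_pattern_def patterns_def A_def)
    have comm: "pattern_rel z a b \<longleftrightarrow> pattern_rel z b a" for z :: "'a option set set" and a b
      by (auto simp: pattern_rel_def)
    have none: "pattern_rel z None None" if "partition_on A z" for z
      using that by (auto simp: pattern_rel_def partition_on_def A_def)
    show "pattern_rel x a b \<longleftrightarrow> pattern_rel (A // R) a b" if "a \<in> A" "b \<in> A" for a b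
      using that x ex none[OF px] none[OF part] comm[of x a b] comm[of "A // R" a b]
      unfolding A_def induces_pattern_def by (elim insertE imageE) simp_all
  qed
  ultimately show ?thesis by blast
qed

lemma layer_pattern_eq_iff: "layer_pattern V E r n \<omega> = x \<longleftrightarrow> induces_pattern V E r n \<omega> x"
  unfolding layer_pattern_def
  using theI'[OF ex1_induces_pattern] the1_equality[OF ex1_induces_pattern] by metis

definition connected_count ::
  "'a set \<Rightarrow> 'a set set \<Rightarrow> 'a \<Rightarrow> int \<Rightarrow> (('a \<times> int) set \<Rightarrow> bool) \<Rightarrow> nat" where
  "connected_count V E r n \<omega> = card {v' \<in> V \<times> {n}. conn V E \<omega> v' (r, 0)}"

end

theory Submission imports Defs begin

text \<open>The open edges of one layer act on patterns (with the star) by an \<^emph>\<open>idempotent\<close> map, so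
  the patterns form a Markov chain in which every step can be repeated without changing the result.
  It suffices to find one \<open>N\<close>, valid for all \<open>p\<close> and all initial patterns, such that the kernel of
  the chain on patterns that contain the star satisfies \<open>K (N + 1) z x \<le> K N z x\<close>, as this inequality is
  inherited by all larger \<open>n\<close>. A long path visits some pattern three times; deleting one of the two loops
  and repeating instead the likeliest step of the other loop gives a path that is one step
  shorter and whose weight is larger by the inverse probability of that step.
  For \<open>p\<close> near \<open>0\<close> this settles the claim, since a layer without open edges kills the star and all
  other layers have probability at most \<open>p\<close>. For \<open>p\<close> near \<open>1\<close> one decomposes with respect to the last fully
  open layer: the survival probability decreases by the factor \<open>1 - (1 - p) ^ card L\<close> per step,
  while long stretches without fully open layers are negligible by the loop argument.
  For \<open>p\<close> bounded away from \<open>0\<close> and \<open>1\<close> the largest ratio \<open>K (n + 1) z x / K n z x\<close> over \<open>x\<close>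
  decreases below \<open>1\<close> after a number of steps that is uniform in \<open>p\<close>.
  The remaining claims follow by shift invariance, since connections to layer \<open>n\<close> depend only on the pattern
  of layer \<open>n\<close> and on the edges above it.\<close>

subsection \<open>Ratios of successive masses of a substochastic chain\<close>

text \<open>One step of the chain is a linear map with nonnegative coefficients, so it preserves the
  pointwise inequality between two successive mass vectors. With \<open>D = 1\<close> this extends
  monotonicity from one \<open>N\<close> to all later times.\<close>

lemma ratio_bound_propagates:
  fixes T :: "'s \<Rightarrow> 's \<Rightarrow> real" and \<mu> :: "nat \<Rightarrow> 's \<Rightarrow> real"
  assumes T: "\<And>y x. 0 \<le> T y x"
    and step: "\<And>n x. x \<in> M \<Longrightarrow> \<mu> (Suc n) x = (\<Sum>y\<in>M. \<mu> n y * T y x)"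
    and bound: "\<And>x. x \<in> M \<Longrightarrow> \<mu> (Suc n) x \<le> D * \<mu> n x"
  shows "x \<in> M \<Longrightarrow> \<mu> (Suc (n + k)) x \<le> D * \<mu> (n + k) x"
proof (induction k arbitrary: x)
  case 0
  then show ?case using bound by simp
next
  case (Suc k)
  have "\<mu> (Suc (n + Suc k)) x = (\<Sum>y\<in>M. \<mu> (Suc (n + k)) y * T y x)"
    using step[OF Suc.prems] by simp
  also have "\<dots> \<le> (\<Sum>y\<in>M. D * \<mu> (n + k) y * T y x)"
    by (intro sum_mono mult_right_mono T Suc.IH)
  also have "\<dots> = D * \<mu> (n + Suc k) x"
    using step[OF Suc.prems] by (simp add: sum_distrib_left mult.assoc)
  finally show ?case .
qed

text \<open>The states whose ratio \<open>\<mu> (k + 1) x / \<mu> k x\<close> almost attains the bound form a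
  nested sequence of sets as \<open>k\<close> grows, since each ratio is a weighted average of the ratios at the
  predecessors and the state itself is a predecessor of non-negligible weight. By the pigeonhole
  principle two consecutive sets agree; on such a set nearly all incoming mass comes from the set
  itself, so its total mass must shrink by the factor \<open>1 - \<delta>\<close>.\<close>

lemma ratio_bound_improves:
  fixes T :: "'s \<Rightarrow> 's \<Rightarrow> real" and \<mu> :: "nat \<Rightarrow> 's \<Rightarrow> real"
  assumes fin: "finite M"
    and T: "\<And>y x. 0 \<le> T y x"
    and rows: "\<And>y A. y \<in> M \<Longrightarrow> A \<subseteq> M \<Longrightarrow> (\<Sum>x\<in>A. T y x) \<le> 1 - \<delta>"
    and \<mu>: "\<And>n x. 0 \<le> \<mu> n x"
    and step: "\<And>n x. x \<in> M \<Longrightarrow> \<mu> (Suc n) x = (\<Sum>y\<in>M. \<mu> n y * T y x)"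
    and diag: "\<And>n x. x \<in> M \<Longrightarrow> 0 < \<mu> (Suc n) x \<Longrightarrow> c \<le> T x x"
    and const: "2 < K" "2 * D0 < K * c" "0 < \<eta>" "K ^ card M * \<eta> < 1"
      "1 - \<delta> < (1 - 2 / K) * (1 - K ^ card M * \<eta>)" "1 \<le> D" "D + \<eta> \<le> D0"
    and bound: "\<And>x. x \<in> M \<Longrightarrow> \<mu> (Suc n) x \<le> (D + \<eta>) * \<mu> n x"
  shows "x \<in> M \<Longrightarrow> \<mu> (Suc (n + card M)) x \<le> D * \<mu> (n + card M) x"
proof (rule ccontr)
  assume x0: "x \<in> M" and not: "\<not> \<mu> (Suc (n + card M)) x \<le> D * \<mu> (n + card M) x"
  define m where "m = card M"
  \<comment> \<open>The tolerance below the near-maximal ratio \<open>D\<close> shrinks by the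
    factor \<open>K\<close> when \<open>i\<close> grows by one and ends at \<open>\<eta>\<close> for
    \<open>i = m\<close>. This gap of a factor \<open>K\<close> between consecutive levels drives
    the averaging argument.\<close>
  define A where "A i = {x \<in> M. (D - K ^ (m - i) * \<eta>) * \<mu> (n + i) x \<le> \<mu> (Suc (n + i)) x
                            \<and> 0 < \<mu> (n + i) x}" for i
  have K: "0 < K" "1 \<le> K" using const by auto
  have bd: "\<mu> (Suc (n + i)) x \<le> (D + \<eta>) * \<mu> (n + i) x" if "x \<in> M" for x i
    using ratio_bound_propagates[of T M \<mu> n "D + \<eta>", OF T step bound that] .
  have small: "K ^ j * \<eta> < 1" if "j \<le> m" for j
  proof -
    have "K ^ j * \<eta> \<le> K ^ m * \<eta>"
      using K const that by (intro mult_right_mono power_increasing) auto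
    also have "\<dots> < 1" using const m_def by simp
    finally show ?thesis .
  qed
  have "x \<in> A m"
  proof -
    have "0 < \<mu> (n + m) x"
    proof (rule ccontr)
      assume "\<not> 0 < \<mu> (n + m) x"
      then have "\<mu> (n + m) x = 0" using \<mu>[of "n + m" x] by simp
      then show False using bd[OF x0, of m] not m_def by simp
    qed
    moreover have "(D - \<eta>) * \<mu> (n + m) x \<le> D * \<mu> (n + m) x"
      using const calculation by (intro mult_right_mono) auto
    then have "(D - \<eta>) * \<mu> (n + m) x \<le> \<mu> (Suc (n + m)) x"
      using not unfolding m_def by linarith
    ultimately show ?thesis using x0 by (simp add: A_def)
  qed
  \<comment> \<open>A Markov-type inequality for deficits: the ratio at \<open>x\<close> is an
    average over its predecessors and falls short of \<open>D\<close> by at most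
    \<open>\<theta>\<close>. Predecessors outside \<open>A i\<close> fall short by at least
    \<open>K * \<theta>\<close>, those inside exceed \<open>D\<close> by at most
    \<open>\<eta> \<le> \<theta>\<close>. Hence those outside supply at most the share
    \<open>2 / K\<close> of the mass at \<open>x\<close>.\<close>
  have key: "A (Suc i) \<subseteq> A i \<and>
      (\<forall>x\<in>A (Suc i). (1 - 2 / K) * \<mu> (Suc (n + i)) x \<le> (\<Sum>y\<in>A i. \<mu> (n + i) y * T y x))"
    if i: "i < m" for i
  proof -
    define \<theta> where "\<theta> = K ^ (m - Suc i) * \<eta>"
    have \<theta>: "\<eta> \<le> \<theta>" "0 < \<theta>"
      using K const unfolding \<theta>_def by (auto simp: one_le_power)
    have K\<theta>: "K ^ (m - i) * \<eta> = K * \<theta>"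
      using i by (simp add: \<theta>_def Suc_diff_Suc flip: power_Suc mult.assoc)
    have Kt1: "K * \<theta> < 1" using small[of "m - i"] K\<theta> by simp
    have main: "(1 - 2 / K) * \<mu> (Suc (n + i)) x \<le> (\<Sum>y\<in>A i. \<mu> (n + i) y * T y x) \<and> x \<in> A i"
      if x: "x \<in> A (Suc i)" for x
    proof -
      have xM: "x \<in> M" and pos: "0 < \<mu> (Suc (n + i)) x"
        and ge: "(D - \<theta>) * \<mu> (Suc (n + i)) x \<le> \<mu> (Suc (Suc (n + i))) x"
        using x by (auto simp: A_def \<theta>_def)
      define W where "W = (\<Sum>y\<in>M - A i. \<mu> (n + i) y * T y x)"
      define U where "U = (\<Sum>y\<in>A i. \<mu> (n + i) y * T y x)"
      have AM: "A i \<subseteq> M" by (auto simp: A_def)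
      have UW: "\<mu> (Suc (n + i)) x = U + W"
        unfolding step[OF xM] U_def W_def by (subst sum.subset_diff[OF AM fin]) simp
      have "\<mu> (Suc (Suc (n + i))) x = (\<Sum>y\<in>M. \<mu> (Suc (n + i)) y * T y x)"
        by (rule step[OF xM])
      also have "\<dots> = (\<Sum>y\<in>M - A i. \<mu> (Suc (n + i)) y * T y x) + (\<Sum>y\<in>A i. \<mu> (Suc (n + i)) y * T y x)"
        by (rule sum.subset_diff[OF AM fin])
      also have "\<dots> \<le> (\<Sum>y\<in>M - A i. (D - K * \<theta>) * \<mu> (n + i) y * T y x)
                      + (\<Sum>y\<in>A i. (D + \<eta>) * \<mu> (n + i) y * T y x)"
      proof (intro add_mono sum_mono mult_right_mono T)
        fix y assume y: "y \<in> M - A i"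
        show "\<mu> (Suc (n + i)) y \<le> (D - K * \<theta>) * \<mu> (n + i) y"
        proof (cases "\<mu> (n + i) y = 0")
          case True
          then show ?thesis using bd[of y i] y by simp
        next
          case False
          then have "0 < \<mu> (n + i) y" using \<mu>[of "n + i" y] by simp
          then show ?thesis using y K\<theta> by (auto simp: A_def)
        qed
      next
        fix y assume "y \<in> A i"
        then show "\<mu> (Suc (n + i)) y \<le> (D + \<eta>) * \<mu> (n + i) y"
          using AM by (intro bd) auto
      qed
      also have "\<dots> = (D - K * \<theta>) * W + (D + \<eta>) * U"
        by (simp add: W_def U_def sum_distrib_left mult.assoc)
      finally have "(D - \<theta>) * (U + W) \<le> (D - K * \<theta>) * W + (D + \<eta>) * U"
        using ge UW by simp
      then have "K * \<theta> * W \<le> \<theta> * W + (\<theta> + \<eta>) * U" by (simp add: algebra_simps)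
      moreover have "0 \<le> W" "0 \<le> U"
        unfolding W_def U_def by (auto intro!: sum_nonneg mult_nonneg_nonneg \<mu> T)
      moreover have "\<theta> * W + (\<theta> + \<eta>) * U \<le> 2 * \<theta> * (U + W)"
      proof -
        have "(\<theta> + \<eta>) * U \<le> 2 * \<theta> * U" using \<theta> \<open>0 \<le> U\<close> by (intro mult_right_mono) auto
        moreover have "\<theta> * W \<le> 2 * \<theta> * W" using \<theta> \<open>0 \<le> W\<close> by (intro mult_right_mono) auto
        ultimately show ?thesis by (simp add: algebra_simps)
      qed
      ultimately have "\<theta> * (K * W) \<le> \<theta> * (2 * (U + W))" by (simp add: algebra_simps)
      then have KW: "K * W \<le> 2 * (U + W)" using \<theta> by simp
      have first: "(1 - 2 / K) * (U + W) \<le> U" using KW K by (simp add: field_simps)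
      \<comment> \<open>Otherwise the mass that \<open>x\<close> sends to itself, at least the
        fraction \<open>c\<close>, would be part of the small outside share \<open>W\<close>; this
        contradicts \<open>2 * D0 < K * c\<close>.\<close>
      have "x \<in> A i"
      proof (rule ccontr)
        assume "x \<notin> A i"
        then have "\<mu> (n + i) x * T x x \<le> W"
          unfolding W_def using xM fin by (intro member_le_sum) (auto intro!: mult_nonneg_nonneg \<mu> T)
        moreover have "\<mu> (n + i) x * c \<le> \<mu> (n + i) x * T x x"
          using diag[OF xM pos] \<mu> by (intro mult_left_mono)
        ultimately have "K * (\<mu> (n + i) x * c) \<le> 2 * \<mu> (Suc (n + i)) x"
          using KW K UW by (smt (verit) mult_left_mono)
        also have "\<dots> \<le> 2 * ((D + \<eta>) * \<mu> (n + i) x)" using bd[OF xM, of i] by simp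
        also have "\<dots> \<le> 2 * (D0 * \<mu> (n + i) x)"
          using const \<mu>[of "n+i" x] by (intro mult_left_mono mult_right_mono) auto
        finally have "(K * c) * \<mu> (n + i) x \<le> (2 * D0) * \<mu> (n + i) x" by (simp add: algebra_simps)
        moreover have "0 < \<mu> (n + i) x"
          using bd[OF xM, of i] pos \<mu>[of "n + i" x] by (cases "\<mu> (n + i) x = 0") auto
        ultimately show False using const by simp
      qed
      then show ?thesis using first UW U_def by simp
    qed
    then show ?thesis by auto
  qed
  have sub: "A i \<subseteq> M" for i by (auto simp: A_def)
  then have finA: "finite (A i)" for i using fin finite_subset by blast
  \<comment> \<open>If all \<open>m\<close> inclusions were strict, the cardinalities would drop
    from at most \<open>card M = m\<close> to \<open>0\<close>, although
    \<open>x \<in> A m\<close>.\<close>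
  have "\<exists>i<m. A (Suc i) = A i"
  proof (rule ccontr)
    assume "\<not> (\<exists>i<m. A (Suc i) = A i)"
    then have lt: "card (A (Suc i)) < card (A i)" if "i < m" for i
      using key[OF that] that by (intro psubset_card_mono finA) auto
    have "card (A i) + i \<le> m" if "i \<le> m" for i
      using that
    proof (induction i)
      case 0
      then show ?case using card_mono[OF fin sub[of 0]] m_def by simp
    next
      case (Suc i)
      then show ?case using lt[of i] by simp
    qed
    from this[of m] have "A m = {}" using finA by simp
    then show False using \<open>x \<in> A m\<close> by simp
  qed
  then obtain i where i: "i < m" "A (Suc i) = A i" by blast
  have "x \<in> A j" if "j \<le> m" for j
    using that by (induction rule: inc_induct) (use \<open>x \<in> A m\<close> key in auto)
  then have xA: "x \<in> A i" using i by simp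
  define \<Sigma> where "\<Sigma> = (\<Sum>y\<in>A i. \<mu> (n + i) y)"
  have \<Sigma>: "0 < \<Sigma>"
    unfolding \<Sigma>_def using xA finA \<mu> by (intro sum_pos2[of _ x]) (auto simp: A_def)
  have small_i: "K ^ (m - i) * \<eta> \<le> K ^ m * \<eta>"
    using K const by (intro mult_right_mono power_increasing) auto
  \<comment> \<open>The next mass of \<open>A i\<close> is estimated in two ways: from below by the
    near-maximal ratios, which are at least \<open>1 - K ^ m * \<eta>\<close> because
    \<open>1 \<le> D\<close>, and from above by the row sums, since nearly all of it comes from
    \<open>A i\<close> itself.\<close>
  have "(1 - 2 / K) * ((1 - K ^ m * \<eta>) * \<Sigma>) = (\<Sum>y\<in>A i. (1 - 2 / K) * ((1 - K ^ m * \<eta>) * \<mu> (n + i) y))"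
    by (simp add: \<Sigma>_def sum_distrib_left)
  also have "\<dots> \<le> (\<Sum>y\<in>A i. (1 - 2 / K) * \<mu> (Suc (n + i)) y)"
  proof (intro sum_mono mult_left_mono)
    fix y assume y: "y \<in> A i"
    have "(1 - K ^ m * \<eta>) * \<mu> (n + i) y \<le> (D - K ^ (m - i) * \<eta>) * \<mu> (n + i) y"
    proof (rule mult_right_mono[OF _ \<mu>])
      show "1 - K ^ m * \<eta> \<le> D - K ^ (m - i) * \<eta>" using small_i const(6) by linarith
    qed
    also have "\<dots> \<le> \<mu> (Suc (n + i)) y" using y unfolding A_def by blast
    finally show "(1 - K ^ m * \<eta>) * \<mu> (n + i) y \<le> \<mu> (Suc (n + i)) y" .
  qed (use const in auto)
  also have "\<dots> \<le> (\<Sum>x\<in>A i. \<Sum>y\<in>A i. \<mu> (n + i) y * T y x)"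
    using key[OF i(1)] i(2) by (intro sum_mono) auto
  also have "\<dots> = (\<Sum>y\<in>A i. \<mu> (n + i) y * (\<Sum>x\<in>A i. T y x))"
    by (subst sum.swap) (simp add: sum_distrib_left)
  also have "\<dots> \<le> (\<Sum>y\<in>A i. \<mu> (n + i) y * (1 - \<delta>))"
    using sub \<mu> by (intro sum_mono mult_left_mono rows) auto
  also have "\<dots> = (1 - \<delta>) * \<Sigma>" by (simp add: \<Sigma>_def sum_distrib_left mult.commute)
  finally have "((1 - 2 / K) * (1 - K ^ m * \<eta>)) * \<Sigma> \<le> (1 - \<delta>) * \<Sigma>" by (simp add: mult.assoc)
  then show False using \<Sigma> const m_def by simp
qed

subsection \<open>Chains driven by idempotent maps\<close>

lemma three_elements:
  assumes "3 \<le> card (I :: nat set)"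
  obtains i j k where "i \<in> I" "j \<in> I" "k \<in> I" "i < j" "j < k"
proof -
  have fin: "finite I" using assms card.infinite by fastforce
  define i where "i = Min I"
  define k where "k = Max I"
  have "I \<noteq> {}" using assms by auto
  then have ik: "i \<in> I" "k \<in> I" using fin by (auto simp: i_def k_def)
  have "card {i, k} \<le> 2" by (simp add: card_insert_if)
  then have "card I - card {i, k} \<noteq> 0" using assms by linarith
  then have "card (I - {i, k}) \<noteq> 0" using ik fin by (subst card_Diff_subset) auto
  then obtain j where j: "j \<in> I" "j \<noteq> i" "j \<noteq> k"
    by (metis Diff_iff card.empty ex_in_conv insertCI)
  then have "i < j" "j < k"
    using fin Min_le[of I j] Max_ge[of I j] by (auto simp: i_def k_def intro: le_neq_trans)
  then show ?thesis using that ik j by blast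
qed

text \<open>Here \<open>M\<close> stands for the states in which the star is still alive,
  \<open>L\<close> for the edges of one layer, and \<open>F \<eta>\<close> for the effect of a layer
  whose set of open edges is \<open>\<eta>\<close>. States outside \<open>M\<close> are dead for
  good.\<close>

locale absorbing_chain =
  fixes M :: "'s set" and L :: "'e set" and F :: "'e set \<Rightarrow> 's \<Rightarrow> 's" and s :: 's
  assumes finite_M: "finite M" and finite_L: "finite L"
    and absorbing: "z \<notin> M \<Longrightarrow> F \<eta> z \<notin> M"
    and idem: "F \<eta> z \<in> M \<Longrightarrow> F \<eta> (F \<eta> z) = F \<eta> z"
    and full: "z \<in> M \<Longrightarrow> F L z = s"
    and s_in: "s \<in> M"
    and kill: "F {} z \<notin> M"
begin

text \<open>The set \<open>H\<close> of admissible layers is kept variable: omitting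
  \<open>{}\<close> or \<open>L\<close> from \<open>Pow L\<close> gives the taboo kernels used for
  \<open>p\<close> near \<open>0\<close> and near \<open>1\<close>.\<close>

fun kernel :: "'e set set \<Rightarrow> ('e set \<Rightarrow> real) \<Rightarrow> nat \<Rightarrow> 's \<Rightarrow> 's \<Rightarrow> real" where
  "kernel H w 0 z x = of_bool (z = x)"
| "kernel H w (Suc n) z x = (\<Sum>\<eta>\<in>H. w \<eta> * kernel H w n (F \<eta> z) x)"

definition trans :: "'e set set \<Rightarrow> ('e set \<Rightarrow> real) \<Rightarrow> 's \<Rightarrow> 's \<Rightarrow> real" where
  "trans H w y x = (\<Sum>\<eta>\<in>H. w \<eta> * of_bool (F \<eta> y = x))"

lemma kernel_nonneg: "(\<And>\<eta>. \<eta> \<in> H \<Longrightarrow> 0 \<le> w \<eta>) \<Longrightarrow> 0 \<le> kernel H w n z x"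
  by (induction n arbitrary: z) (auto intro!: sum_nonneg mult_nonneg_nonneg)

lemma trans_nonneg: "(\<And>\<eta>. \<eta> \<in> H \<Longrightarrow> 0 \<le> w \<eta>) \<Longrightarrow> 0 \<le> trans H w y x"
  by (auto simp: trans_def intro!: sum_nonneg)

lemma kernel_dead: "z \<notin> M \<Longrightarrow> x \<in> M \<Longrightarrow> kernel H w n z x = 0"
  by (induction n arbitrary: z) (auto simp: absorbing)

text \<open>The recursion splits off the last step instead of the first one. Summing over
  \<open>M\<close> suffices because a dead state never leads to \<open>x \<in> M\<close>.\<close>

lemma kernel_Suc_right:
  "x \<in> M \<Longrightarrow> kernel H w (Suc n) z x = (\<Sum>y\<in>M. kernel H w n z y * trans H w y x)"
proof (induction n arbitrary: z)
  case 0
  have *: "F \<eta> z = x \<Longrightarrow> z \<in> M" for \<eta> using absorbing 0 by blast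
  have "(\<Sum>y\<in>M. of_bool (z = y) * trans H w y x) = (if z \<in> M then trans H w z x else 0)"
    using finite_M by (simp add: if_distrib[of "\<lambda>t. t * _"] of_bool_def cong: if_cong)
  also have "\<dots> = trans H w z x"
  proof (cases "z \<in> M")
    case False
    then have "F \<eta> z \<noteq> x" for \<eta> using * by blast
    then show ?thesis using False by (simp add: trans_def)
  qed simp
  finally show ?case by (simp add: trans_def)
next
  case (Suc n)
  have "kernel H w (Suc (Suc n)) z x = (\<Sum>\<eta>\<in>H. w \<eta> * kernel H w (Suc n) (F \<eta> z) x)"
    by simp
  also have "\<dots> = (\<Sum>\<eta>\<in>H. \<Sum>y\<in>M. w \<eta> * kernel H w n (F \<eta> z) y * trans H w y x)"
    by (simp only: Suc.IH[OF Suc.prems] sum_distrib_left mult.assoc)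
  also have "\<dots> = (\<Sum>y\<in>M. kernel H w (Suc n) z y * trans H w y x)"
    by (subst sum.swap) (simp add: sum_distrib_right)
  finally show ?case .
qed

section \<open>Path expansion of the kernel and shortening of paths with loops\<close>

definition paths :: "'e set set \<Rightarrow> nat \<Rightarrow> 's \<Rightarrow> 's \<Rightarrow> 'e set list set" where
  "paths H n z x = {\<eta>s. set \<eta>s \<subseteq> H \<and> length \<eta>s = n \<and> fold F \<eta>s z = x}"

lemma finite_paths: "finite H \<Longrightarrow> finite (paths H n z x)"
  by (rule finite_subset[OF _ finite_lists_length_eq[of H n]]) (auto simp: paths_def)

lemma card_paths: "finite H \<Longrightarrow> card (paths H n z x) \<le> card H ^ n"
  unfolding card_lists_length_eq[of H n, symmetric]
  by (rule card_mono[OF finite_lists_length_eq]) (auto simp: paths_def)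

lemma kernel_eq_sum_paths:
  assumes "finite H"
  shows "kernel H w n z x = (\<Sum>\<eta>s\<in>paths H n z x. prod_list (map w \<eta>s))"
proof (induction n arbitrary: z)
  case 0
  have "paths H 0 z x = (if z = x then {[]} else {})" by (auto simp: paths_def)
  then show ?case by simp
next
  case (Suc n)
  have eq: "paths H (Suc n) z x = (\<Union>\<eta>\<in>H. Cons \<eta> ` paths H n (F \<eta> z) x)"
    by (auto simp: paths_def length_Suc_conv image_iff)
  have "(\<Sum>\<eta>s\<in>paths H (Suc n) z x. prod_list (map w \<eta>s))
      = (\<Sum>\<eta>\<in>H. \<Sum>\<eta>s\<in>Cons \<eta> ` paths H n (F \<eta> z) x. prod_list (map w \<eta>s))"
    unfolding eq using assms by (intro sum.UNION_disjoint) (auto intro: finite_paths)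
  also have "\<dots> = (\<Sum>\<eta>\<in>H. w \<eta> * kernel H w n (F \<eta> z) x)"
    by (simp add: sum.reindex inj_on_def sum_distrib_left Suc.IH)
  finally show ?case by simp
qed

lemma fold_alive: "fold F \<eta>s z \<in> M \<Longrightarrow> z \<in> M"
  by (induction \<eta>s arbitrary: z) (simp, use absorbing in fastforce)

lemma funpow_idem: "F \<eta> z \<in> M \<Longrightarrow> m \<noteq> 0 \<Longrightarrow> (F \<eta> ^^ m) z = F \<eta> z"
proof (induction m)
  case (Suc m)
  then show ?case by (cases "m = 0") (simp_all add: idem)
qed simp

text \<open>Let \<open>\<sigma>\<close> be the likeliest step of both loops. The loop without this
  occurrence of \<open>\<sigma>\<close> is deleted and \<open>\<sigma>\<close> is repeated in its
  own loop, which by idempotence leaves the states unchanged. Each deleted step is at most as likely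
  as \<open>\<sigma>\<close>, and the new loop pair has one step less, so a factor
  \<open>w \<sigma> \<le> \<epsilon>\<close> is gained.\<close>

lemma double_loop_shortening:
  assumes B: "fold F B y = y" "B \<noteq> []" and C: "fold F C y = y" "C \<noteq> []" and y: "y \<in> M"
    and w: "\<And>\<eta>. \<eta> \<in> set B \<union> set C \<Longrightarrow> 0 < w \<eta> \<and> w \<eta> \<le> (\<epsilon> :: real)"
  shows "\<exists>D. fold F D y = y \<and> Suc (length D) = length B + length C \<and> set D \<subseteq> set B \<union> set C
            \<and> prod_list (map w B) * prod_list (map w C) \<le> \<epsilon> * prod_list (map w D)"
proof -
  \<comment> \<open>The case that \<open>\<sigma>\<close> lies in the first loop; the other one
    follows by exchanging the loops.\<close>
  have half: "\<exists>D. fold F D y = y \<and> Suc (length D) = length B + length C \<and> set D \<subseteq> set B \<union> set C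
            \<and> prod_list (map w B) * prod_list (map w C) \<le> \<epsilon> * prod_list (map w D)"
    if B: "fold F B y = y" and C: "fold F C y = y" "C \<noteq> []" and \<sigma>: "\<sigma> \<in> set B"
      and w: "\<And>\<eta>. \<eta> \<in> set B \<union> set C \<Longrightarrow> 0 < w \<eta> \<and> w \<eta> \<le> w \<sigma>" "w \<sigma> \<le> \<epsilon>" for B C \<sigma>
  proof -
    from \<sigma> obtain B1 B2 where BB: "B = B1 @ \<sigma> # B2" by (auto simp: in_set_conv_decomp)
    \<comment> \<open>The copies replace the occurrence of \<open>\<sigma>\<close> in
      \<open>B\<close>, so only \<open>length C - 1\<close> steps are added and the total length
      drops by exactly one.\<close>
    define D where "D = B1 @ replicate (length C) \<sigma> @ B2"
    have "F \<sigma> (fold F B1 y) \<in> M"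
      using fold_alive[of B2 "F \<sigma> (fold F B1 y)"] B y by (simp add: BB)
    then have "fold F D y = y"
      using B C by (simp add: D_def BB funpow_idem)
    moreover have "Suc (length D) = length B + length C" by (simp add: D_def BB)
    moreover have "set D \<subseteq> set B \<union> set C" by (auto simp: D_def BB)
    moreover have "prod_list (map w B) * prod_list (map w C) \<le> \<epsilon> * prod_list (map w D)"
    proof -
      have pos: "0 < prod_list (map w xs)" if "set xs \<subseteq> set B" for xs
        using that w(1) by (induction xs) auto
      have le: "prod_list (map w C') \<le> w \<sigma> ^ length C'" if "set C' \<subseteq> set C" for C'
        using that
      proof (induction C')
        case (Cons a C')
        then show ?case using w(1)[of a] w(1)[of \<sigma>] \<sigma>
          by (auto intro!: mult_mono prod_list_nonneg less_imp_le[OF conjunct1[OF w(1)]])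
      qed simp
      have "prod_list (map w B) * prod_list (map w C) \<le> prod_list (map w B) * w \<sigma> ^ length C"
        using pos[of B] le[of C] by (intro mult_left_mono) auto
      also have "\<dots> = w \<sigma> * prod_list (map w D)"
        by (simp add: BB D_def prod_list_replicate)
      also have "\<dots> \<le> \<epsilon> * prod_list (map w D)"
      proof (rule mult_right_mono[OF w(2)])
        have "set D \<subseteq> set B" by (auto simp: D_def BB)
        then show "0 \<le> prod_list (map w D)" using pos less_imp_le by blast
      qed
      finally show ?thesis .
    qed
    ultimately show ?thesis by blast
  qed
  have "\<exists>\<sigma>\<in>set B \<union> set C. \<forall>\<eta>\<in>set B \<union> set C. w \<eta> \<le> w \<sigma>"
  proof -
    have "finite (w ` (set B \<union> set C))" "w ` (set B \<union> set C) \<noteq> {}" using B by auto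
    from Max_in[OF this] Max_ge[OF this(1)] show ?thesis by fastforce
  qed
  then obtain \<sigma> where \<sigma>: "\<sigma> \<in> set B \<union> set C" "\<And>\<eta>. \<eta> \<in> set B \<union> set C \<Longrightarrow> w \<eta> \<le> w \<sigma>"
    by blast
  show ?thesis
  proof (cases "\<sigma> \<in> set B")
    case True
    then show ?thesis using half[of B C \<sigma>] B C \<sigma> w by blast
  next
    case False
    then have "\<sigma> \<in> set C" using \<sigma> by simp
    then show ?thesis
      using half[of C B \<sigma>] B C \<sigma> w by (simp add: Un_commute add.commute mult.commute)
  qed
qed

text \<open>All states on the path are alive because the last one is. The path has
  \<open>n + 2 > 2 * card M\<close> states, so some state occurs three times and bounds two
  consecutive loops.\<close>

lemma path_shortening:
  assumes \<eta>s: "\<eta>s \<in> paths H (Suc n) z x" and x: "x \<in> M" and n: "2 * card M \<le> n"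
    and w: "\<And>\<eta>. \<eta> \<in> H \<Longrightarrow> 0 < w \<eta> \<and> w \<eta> \<le> (\<epsilon> :: real)"
  shows "\<exists>\<eta>s'\<in>paths H n z x. prod_list (map w \<eta>s) \<le> \<epsilon> * prod_list (map w \<eta>s')"
proof -
  have set: "set \<eta>s \<subseteq> H" and len: "length \<eta>s = Suc n" and fold: "fold F \<eta>s z = x"
    using \<eta>s by (auto simp: paths_def)
  define st where "st i = fold F (take i \<eta>s) z" for i
  have st: "st i \<in> M" for i
  proof -
    have "fold F (drop i \<eta>s) (st i) = x"
      using fold append_take_drop_id[of i \<eta>s] unfolding st_def by (metis fold_append comp_apply)
    then show ?thesis using x fold_alive by blast
  qed
  have "\<exists>y\<in>M. 3 \<le> card {i \<in> {..Suc n}. st i = y}"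
  proof (rule ccontr)
    assume "\<not> ?thesis"
    then have *: "card {i \<in> {..Suc n}. st i = y} \<le> 2" if "y \<in> M" for y using that by force
    have "{..Suc n} = (\<Union>y\<in>M. {i \<in> {..Suc n}. st i = y})" using st by auto
    then have "card {..Suc n} \<le> (\<Sum>y\<in>M. card {i \<in> {..Suc n}. st i = y})"
      using card_UN_le[OF finite_M] by metis
    also have "\<dots> \<le> (\<Sum>y\<in>M. 2)" by (intro sum_mono *)
    finally show False using n by simp
  qed
  then obtain y where "y \<in> M" "3 \<le> card {i \<in> {..Suc n}. st i = y}" by blast
  then obtain i j k where ijk: "i < j" "j < k" "k \<le> Suc n" "st i = y" "st j = y" "st k = y"
    by (elim three_elements) auto
  define P where "P = take i \<eta>s"
  define B where "B = take (j - i) (drop i \<eta>s)"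
  define C where "C = take (k - j) (drop j \<eta>s)"
  define S where "S = drop k \<eta>s"
  have tj: "take j \<eta>s = P @ B"
    unfolding P_def B_def using ijk by (metis le_add_diff_inverse less_imp_le_nat take_add)
  have tk: "take k \<eta>s = take j \<eta>s @ C"
    unfolding C_def using ijk by (metis le_add_diff_inverse less_imp_le_nat take_add)
  have eq: "\<eta>s = P @ B @ C @ S"
    using append_take_drop_id[of k \<eta>s] tj tk S_def by simp
  have fP: "fold F P z = y" using ijk by (simp add: st_def P_def)
  have fB: "fold F B y = y" using ijk tj fP by (simp add: st_def)
  have fC: "fold F C y = y" using ijk tj tk fP fB by (simp add: st_def)
  have "B \<noteq> []" "C \<noteq> []" using ijk len by (auto simp: B_def C_def)
  moreover have "set B \<union> set C \<subseteq> H" using set eq by auto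
  ultimately obtain D where D: "fold F D y = y" "Suc (length D) = length B + length C"
      "set D \<subseteq> set B \<union> set C"
      and le: "prod_list (map w B) * prod_list (map w C) \<le> \<epsilon> * prod_list (map w D)"
    using double_loop_shortening[of B y C w \<epsilon>] fB fC \<open>y \<in> M\<close> w by blast
  define \<eta>s' where "\<eta>s' = P @ D @ S"
  have "\<eta>s' \<in> paths H n z x"
    using D eq set len fold fP fB fC by (auto simp: paths_def \<eta>s'_def)
  moreover have "prod_list (map w \<eta>s) \<le> \<epsilon> * prod_list (map w \<eta>s')"
  proof -
    have nn: "0 \<le> prod_list (map w xs)" if "set xs \<subseteq> H" for xs
      using that w by (intro prod_list_nonneg) (auto intro: less_imp_le)
    have "prod_list (map w P) * (prod_list (map w B) * prod_list (map w C)) * prod_list (map w S)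
       \<le> prod_list (map w P) * (\<epsilon> * prod_list (map w D)) * prod_list (map w S)"
      using set eq by (intro mult_right_mono mult_left_mono le nn) auto
    then show ?thesis by (simp add: eq \<eta>s'_def mult_ac)
  qed
  ultimately show ?thesis by blast
qed

text \<open>Each path of length \<open>Suc n\<close> is bounded by \<open>\<epsilon>\<close> times
  the weight of a single path of length \<open>n\<close>, hence by \<open>\<epsilon>\<close> times
  the whole kernel; the factor \<open>card H ^ Suc n\<close> counts the longer paths. The shortening
  may send many paths to the same one.\<close>

lemma kernel_Suc_le:
  assumes H: "finite H" and x: "x \<in> M" and n: "2 * card M \<le> n" and "0 \<le> \<epsilon>"
    and w: "\<And>\<eta>. \<eta> \<in> H \<Longrightarrow> 0 < w \<eta> \<and> w \<eta> \<le> \<epsilon>"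
  shows "kernel H w (Suc n) z x \<le> \<epsilon> * card H ^ Suc n * kernel H w n z x"
proof -
  have nn: "0 \<le> prod_list (map w xs)" if "xs \<in> paths H n z x" for xs
    using that w by (intro prod_list_nonneg) (auto simp: paths_def intro: less_imp_le)
  have "prod_list (map w \<eta>s) \<le> \<epsilon> * kernel H w n z x" if \<eta>s: "\<eta>s \<in> paths H (Suc n) z x" for \<eta>s
  proof -
    obtain \<eta>s' where *: "\<eta>s' \<in> paths H n z x" "prod_list (map w \<eta>s) \<le> \<epsilon> * prod_list (map w \<eta>s')"
      using path_shortening[OF \<eta>s x n, of w \<epsilon>] w by blast
    have "prod_list (map w \<eta>s') \<le> kernel H w n z x"
      unfolding kernel_eq_sum_paths[OF H]
      using * finite_paths[OF H] nn by (intro member_le_sum) auto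
    then show ?thesis using * \<open>0 \<le> \<epsilon>\<close> by (meson mult_left_mono order_trans)
  qed
  then have "kernel H w (Suc n) z x \<le> card (paths H (Suc n) z x) * (\<epsilon> * kernel H w n z x)"
    unfolding kernel_eq_sum_paths[OF H, of w "Suc n"] by (intro sum_bounded_above)
  also have "\<dots> \<le> real (card H ^ Suc n) * (\<epsilon> * kernel H w n z x)"
  proof (rule mult_right_mono)
    show "real (card (paths H (Suc n) z x)) \<le> real (card H ^ Suc n)"
      using card_paths[OF H] by (simp only: of_nat_le_iff)
    show "0 \<le> \<epsilon> * kernel H w n z x"
      using \<open>0 \<le> \<epsilon>\<close> w by (intro mult_nonneg_nonneg kernel_nonneg) (auto intro: less_imp_le)
  qed
  finally show ?thesis by (simp add: mult_ac)
qed

section \<open>Bernoulli weights, survival mass and the last fully open layer\<close>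

definition weight :: "real \<Rightarrow> 'e set \<Rightarrow> real" where
  "weight p \<eta> = p ^ card \<eta> * (1 - p) ^ card (L - \<eta>)"

definition mass :: "('e set \<Rightarrow> real) \<Rightarrow> nat \<Rightarrow> 's \<Rightarrow> real" where
  "mass w n z = (\<Sum>y\<in>M. kernel (Pow L) w n z y)"

text \<open>The empty configuration kills every state, so its weight is missing from each
  row.\<close>

lemma sum_trans_le:
  assumes w: "\<And>\<eta>. \<eta> \<in> Pow L \<Longrightarrow> 0 \<le> w \<eta>" "(\<Sum>\<eta>\<in>Pow L. w \<eta>) = 1" and A: "A \<subseteq> M"
  shows "(\<Sum>x\<in>A. trans (Pow L) w y x) \<le> 1 - w {}"
proof -
  have fA: "finite A" using A finite_M finite_subset by blast
  have "(\<Sum>x\<in>A. trans (Pow L) w y x) = (\<Sum>\<eta>\<in>Pow L. w \<eta> * (\<Sum>x\<in>A. of_bool (F \<eta> y = x)))"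
    unfolding trans_def by (subst sum.swap) (simp add: sum_distrib_left)
  also have "\<dots> = (\<Sum>\<eta>\<in>Pow L. w \<eta> * of_bool (F \<eta> y \<in> A))"
    using fA by (simp add: of_bool_def)
  also have "\<dots> \<le> (\<Sum>\<eta>\<in>Pow L. w \<eta> - (if \<eta> = {} then w \<eta> else 0))"
    using kill A w(1) by (intro sum_mono) auto
  also have "\<dots> = 1 - w {}"
    using w(2) finite_L by (simp add: sum_subtractf sum.delta)
  finally show ?thesis .
qed

lemma mass_Suc_le:
  assumes w: "\<And>\<eta>. \<eta> \<in> Pow L \<Longrightarrow> 0 \<le> w \<eta>" "(\<Sum>\<eta>\<in>Pow L. w \<eta>) = 1"
  shows "mass w (Suc n) z \<le> (1 - w {}) * mass w n z"
proof -
  have "mass w (Suc n) z = (\<Sum>y\<in>M. kernel (Pow L) w n z y * (\<Sum>x\<in>M. trans (Pow L) w y x))"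
    unfolding mass_def sum_distrib_left
    by (subst sum.swap) (intro sum.cong refl, simp only: kernel_Suc_right)
  also have "\<dots> \<le> (\<Sum>y\<in>M. kernel (Pow L) w n z y * (1 - w {}))"
    using w by (intro sum_mono mult_left_mono sum_trans_le kernel_nonneg) auto
  finally show ?thesis by (simp add: mass_def sum_distrib_left mult.commute)
qed

text \<open>Having \<open>n\<close> fully open layers in a row is one way to survive.\<close>

lemma mass_ge:
  assumes w: "\<And>\<eta>. \<eta> \<in> Pow L \<Longrightarrow> 0 \<le> w \<eta>"
  shows "z \<in> M \<Longrightarrow> w L ^ n \<le> mass w n z"
proof (induction n arbitrary: z)
  case 0
  then show ?case using finite_M by (simp add: mass_def of_bool_def)
next
  case (Suc n)
  have "w L ^ Suc n \<le> w L * mass w n s"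
    using Suc.IH[OF s_in] w by (auto intro: mult_left_mono)
  also have "\<dots> = w L * mass w n (F L z)" using full Suc.prems by simp
  also have "\<dots> \<le> (\<Sum>\<eta>\<in>Pow L. w \<eta> * mass w n (F \<eta> z))"
    using finite_L w kernel_nonneg[of "Pow L" w]
    by (intro member_le_sum[of L "Pow L" "\<lambda>\<eta>. w \<eta> * mass w n (F \<eta> z)"])
       (auto simp: mass_def intro!: mult_nonneg_nonneg sum_nonneg)
  also have "\<dots> = mass w (Suc n) z"
    unfolding mass_def kernel.simps sum_distrib_left by (rule sum.swap)
  finally show ?case .
qed

text \<open>Decomposition with respect to the last fully open layer, after which the chain
  restarts in the state \<open>s\<close>.\<close>

lemma kernel_last_full:
  "x \<in> M \<Longrightarrow> kernel (Pow L) w n z x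
     = (\<Sum>j<n. w L * mass w (n - 1 - j) z * kernel (Pow L - {L}) w j s x)
       + kernel (Pow L - {L}) w n z x"
proof (induction n arbitrary: x)
  case 0
  then show ?case by simp
next
  case (Suc n)
  let ?H = "Pow L - {L}"
  \<comment> \<open>A fully open layer leads to \<open>s\<close> from every living state and so
    contributes a term independent of \<open>y\<close>. In the sums, \<open>j\<close> counts the
    layers after the last fully open one and \<open>n - 1 - j\<close> those before it.\<close>
  have tr: "trans (Pow L) w y x = w L * of_bool (s = x) + trans ?H w y x" if "y \<in> M" for y
    unfolding trans_def using finite_L full[OF that]
    by (subst sum.remove[of _ L]) auto
  have "kernel (Pow L) w (Suc n) z x
      = (\<Sum>y\<in>M. kernel (Pow L) w n z y * (w L * of_bool (s = x) + trans ?H w y x))"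
    unfolding kernel_Suc_right[OF Suc.prems] by (intro sum.cong refl) (simp add: tr)
  also have "\<dots> = w L * mass w n z * of_bool (s = x)
      + (\<Sum>y\<in>M. kernel (Pow L) w n z y * trans ?H w y x)"
    by (simp add: mass_def algebra_simps sum.distrib sum_distrib_left)
  also have "(\<Sum>y\<in>M. kernel (Pow L) w n z y * trans ?H w y x)
      = (\<Sum>y\<in>M. (\<Sum>j<n. w L * mass w (n - 1 - j) z * (kernel ?H w j s y * trans ?H w y x))
           + kernel ?H w n z y * trans ?H w y x)"
    by (intro sum.cong refl) (simp add: Suc.IH distrib_right sum_distrib_right mult.assoc)
  also have "\<dots> = (\<Sum>j<n. w L * mass w (n - 1 - j) z * (\<Sum>y\<in>M. kernel ?H w j s y * trans ?H w y x))
           + (\<Sum>y\<in>M. kernel ?H w n z y * trans ?H w y x)"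
    by (simp only: sum.distrib sum_distrib_left sum.swap[of _ M])
  also have "\<dots> = (\<Sum>j<n. w L * mass w (n - 1 - j) z * kernel ?H w (Suc j) s x)
           + kernel ?H w (Suc n) z x"
    by (simp only: kernel_Suc_right[OF Suc.prems])
  \<comment> \<open>A fully open layer in the new last step gives the summand \<open>j = 0\<close>;
    all earlier summands move up by one.\<close>
  also have "w L * mass w n z * of_bool (s = x)
     + ((\<Sum>j<n. w L * mass w (n - 1 - j) z * kernel ?H w (Suc j) s x) + kernel ?H w (Suc n) z x)
     = (\<Sum>j<Suc n. w L * mass w (Suc n - 1 - j) z * kernel ?H w j s x) + kernel ?H w (Suc n) z x"
    unfolding sum.lessThan_Suc_shift by (simp del: kernel.simps(2))
  finally show ?case .
qed

text \<open>A path containing an empty layer dies there and cannot end in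
  \<open>x \<in> M\<close>.\<close>

lemma kernel_nonempty:
  "x \<in> M \<Longrightarrow> kernel (Pow L) w n z x = kernel (Pow L - {{}}) w n z x"
proof (induction n arbitrary: z)
  case (Suc n)
  have "kernel (Pow L) w (Suc n) z x
      = w {} * kernel (Pow L) w n (F {} z) x + (\<Sum>\<eta>\<in>Pow L - {{}}. w \<eta> * kernel (Pow L) w n (F \<eta> z) x)"
    using finite_L by (simp add: sum.remove[of _ "{}"])
  then show ?case using Suc kernel_dead[OF kill, of x] by simp
qed simp

lemma kernel_decreasing_from:
  assumes w: "\<And>\<eta>. \<eta> \<in> Pow L \<Longrightarrow> 0 \<le> w \<eta>" and "N \<le> n"
    and "\<And>x. x \<in> M \<Longrightarrow> kernel (Pow L) w (Suc N) z x \<le> kernel (Pow L) w N z x"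
  shows "x \<in> M \<Longrightarrow> kernel (Pow L) w (Suc n) z x \<le> kernel (Pow L) w n z x"
  using ratio_bound_propagates[of "trans (Pow L) w" M "\<lambda>n. kernel (Pow L) w n z" N 1 x "n - N"]
    trans_nonneg[of "Pow L" w] kernel_Suc_right assms by (simp del: kernel.simps(2))

lemma sum_weight: "(\<Sum>\<eta>\<in>Pow L. weight p \<eta>) = 1"
  using prod_add[OF finite_L, of "\<lambda>_. p" "\<lambda>_. 1 - p"] by (simp add: weight_def)

lemma weight_pos: "0 < p \<Longrightarrow> p < 1 \<Longrightarrow> 0 < weight p \<eta>"
  by (simp add: weight_def)

lemma weight_le_1: "0 < p \<Longrightarrow> p < 1 \<Longrightarrow> weight p \<eta> \<le> 1"
  by (simp add: weight_def mult_le_one power_le_one)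

lemma weight_le_p:
  assumes "0 < p" "p < 1" "\<eta> \<subseteq> L" "\<eta> \<noteq> {}"
  shows "weight p \<eta> \<le> p"
proof -
  have "card \<eta> \<noteq> 0" using assms finite_L finite_subset by fastforce
  then have "p ^ card \<eta> \<le> p" using assms power_decreasing[of 1 "card \<eta>" p] by simp
  moreover have "(1 - p) ^ card (L - \<eta>) \<le> 1" using assms by (simp add: power_le_one)
  ultimately show ?thesis
    using mult_mono[of "p ^ card \<eta>" p "(1 - p) ^ card (L - \<eta>)" 1] assms by (simp add: weight_def)
qed

lemma weight_le_q:
  assumes "0 < p" "p < 1" "\<eta> \<subseteq> L" "\<eta> \<noteq> L"
  shows "weight p \<eta> \<le> 1 - p"
proof -
  have "card (L - \<eta>) \<noteq> 0" using assms finite_L by auto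
  then have "(1 - p) ^ card (L - \<eta>) \<le> 1 - p"
    using assms power_decreasing[of 1 "card (L - \<eta>)" "1 - p"] by simp
  moreover have "p ^ card \<eta> \<le> 1" using assms by (simp add: power_le_one)
  ultimately show ?thesis
    using mult_mono[of "p ^ card \<eta>" 1 "(1 - p) ^ card (L - \<eta>)" "1 - p"] assms by (simp add: weight_def)
qed

lemma weight_ge:
  assumes "0 < \<epsilon>" "\<epsilon> \<le> p" "\<epsilon> \<le> 1 - p" "\<eta> \<subseteq> L"
  shows "\<epsilon> ^ card L \<le> weight p \<eta>"
proof -
  have "card L = card \<eta> + card (L - \<eta>)"
    using card_Int_Diff[OF finite_L, of \<eta>] assms(4) by (simp add: Int_absorb1)
  then have "\<epsilon> ^ card L = \<epsilon> ^ card \<eta> * \<epsilon> ^ card (L - \<eta>)" by (simp add: power_add)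
  also have "\<dots> \<le> weight p \<eta>"
    using assms unfolding weight_def by (intro mult_mono power_mono) auto
  finally show ?thesis .
qed

section \<open>Monotonicity for small, large and intermediate \<open>p\<close>\<close>

lemma card_Pow_power_ge_1: "(1 :: real) \<le> real (card (Pow L)) ^ m"
  using finite_L by (simp add: card_Pow one_le_power)

text \<open>Once the empty layer is removed, all remaining weights are at most \<open>p\<close>,
  which outweighs the number of paths in \<open>kernel_Suc_le\<close>.\<close>

lemma kernel_decreasing_small_p:
  assumes p: "0 < p" "p < 1" "p * real (card (Pow L)) ^ Suc (2 * card M) \<le> 1" and x: "x \<in> M"
  shows "kernel (Pow L) (weight p) (Suc (2 * card M)) z x \<le> kernel (Pow L) (weight p) (2 * card M) z x"
proof -
  let ?H = "Pow L - {{}}"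
  let ?n = "2 * card M"
  have nn: "0 \<le> kernel ?H (weight p) ?n z x"
    using p by (intro kernel_nonneg less_imp_le weight_pos)
  have "kernel ?H (weight p) (Suc ?n) z x \<le> p * card ?H ^ Suc ?n * kernel ?H (weight p) ?n z x"
    using finite_L p x by (intro kernel_Suc_le) (auto simp: weight_pos weight_le_p)
  also have "\<dots> \<le> 1 * kernel ?H (weight p) ?n z x"
  proof (rule mult_right_mono[OF _ nn])
    have "real (card ?H) ^ Suc ?n \<le> real (card (Pow L)) ^ Suc ?n"
      using finite_L by (intro power_mono) (auto intro: card_mono)
    then have "p * real (card ?H) ^ Suc ?n \<le> p * real (card (Pow L)) ^ Suc ?n"
      using p by (intro mult_left_mono) auto
    then show "p * real (card ?H ^ Suc ?n) \<le> 1" using p(3) by simp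
  qed
  finally show ?thesis by (simp only: kernel_nonempty[OF x] mult_1)
qed

text \<open>In \<open>kernel_last_full\<close> the survival masses decrease by the factor
  \<open>1 - (1 - p) ^ l\<close>, but one new summand, with \<open>n\<close> layers after the last
  fully open one, appears. It is absorbed by that decrease: \<open>l + 1\<close> applications of the
  loop bound give it a factor of order \<open>(1 - p) ^ Suc l\<close>, one power more than the gain.
  The remaining term without fully open layers decreases by the loop bound alone.\<close>

lemma kernel_decreasing_large_p:
  defines "l \<equiv> card L"
  defines "n \<equiv> 2 * card M + l + 1"
  defines "B \<equiv> real (card (Pow L)) ^ Suc n"
  assumes p: "1 / 2 \<le> p" "p < 1" "(1 - p) * B ^ Suc l \<le> (1 / 2) ^ (l * l)" and z: "z \<in> M" and x: "x \<in> M"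
  shows "kernel (Pow L) (weight p) (Suc n) z x \<le> kernel (Pow L) (weight p) n z x"
proof -
  let ?H = "Pow L - {L}"
  let ?w = "weight p"
  define q where "q = 1 - p"
  define \<psi> where "\<psi> j = kernel ?H ?w j s x" for j
  have p0: "0 < p" using p by linarith
  have q: "0 < q" using p by (simp add: q_def)
  have B: "1 \<le> B" unfolding B_def by (rule card_Pow_power_ge_1)
  have wnn: "0 \<le> ?w \<eta>" for \<eta> using weight_pos[of p \<eta>] p0 p by simp
  have knn: "0 \<le> kernel H ?w m y x" for H m y by (intro kernel_nonneg wnn)
  have drop: "kernel ?H ?w (Suc m) y x \<le> q * B * kernel ?H ?w m y x"
    if m: "2 * card M \<le> m" "m \<le> n" for m y
  proof -
    have "kernel ?H ?w (Suc m) y x \<le> q * card ?H ^ Suc m * kernel ?H ?w m y x"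
      using finite_L p p0 q x m by (intro kernel_Suc_le) (auto simp: weight_pos weight_le_q q_def)
    also have "\<dots> \<le> q * B * kernel ?H ?w m y x"
    proof (rule mult_right_mono[OF mult_left_mono knn])
      have "real (card ?H) ^ Suc m \<le> real (card (Pow L)) ^ Suc m"
        using finite_L by (intro power_mono) (auto intro: card_mono)
      also have "\<dots> \<le> B"
        unfolding B_def using m card_Pow_power_ge_1[of 1] by (intro power_increasing) auto
      finally show "real (card ?H ^ Suc m) \<le> B" by simp
    qed (use q in auto)
    finally show ?thesis .
  qed
  \<comment> \<open>The loop bound requires at least \<open>2 * card M\<close> steps; the
    \<open>l + 1\<close> further steps in \<open>n\<close> allow it to be iterated
    \<open>Suc l\<close> times.\<close>
  have "\<psi> (2 * card M + i) \<le> (q * B) ^ i * \<psi> (2 * card M)" if "i \<le> Suc l" for i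
    using that
  proof (induction i)
    case (Suc i)
    have "\<psi> (2 * card M + Suc i) \<le> q * B * \<psi> (2 * card M + i)"
      using drop[of "2 * card M + i" s] Suc.prems unfolding \<psi>_def n_def by (simp del: kernel.simps)
    also have "\<dots> \<le> q * B * ((q * B) ^ i * \<psi> (2 * card M))"
      using Suc q B by (intro mult_left_mono) auto
    finally show ?case by (simp add: mult.assoc)
  qed simp
  from this[of "Suc l"] have \<psi>n: "\<psi> n \<le> (q * B) ^ Suc l * \<psi> (2 * card M)"
    by (simp add: n_def)
  define S where "S = (\<Sum>j<n. ?w L * mass ?w (n - 1 - j) z * \<psi> j)"
  have mnn: "0 \<le> mass ?w m y" for m y
    unfolding mass_def by (intro sum_nonneg kernel_nonneg wnn)
  have \<psi>nn: "0 \<le> \<psi> j" for j unfolding \<psi>_def by (rule knn)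
  have w0: "?w {} = q ^ l" by (simp add: weight_def q_def l_def)
  have wL: "?w L = p ^ l" by (simp add: weight_def l_def)
  \<comment> \<open>The summand \<open>j = 2 * card M\<close> alone bounds \<open>S\<close> from
    below. There \<open>l\<close> layers precede the last fully open one, and \<open>mass_ge\<close>
    bounds their survival mass by \<open>(p ^ l) ^ l\<close>.\<close>
  have "?w L * p ^ (l * l) * \<psi> (2 * card M) \<le> ?w L * mass ?w l z * \<psi> (2 * card M)"
    using mass_ge[of ?w z l, OF wnn z] wL
    by (intro mult_right_mono mult_left_mono \<psi>nn wnn) (auto simp: power_mult)
  also have "\<dots> \<le> S"
  proof -
    have "n - 1 - 2 * card M = l" by (simp add: n_def)
    then show ?thesis
      unfolding S_def using member_le_sum[of "2 * card M" "{..<n}" "\<lambda>j. ?w L * mass ?w (n - 1 - j) z * \<psi> j"]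
        wnn mnn \<psi>nn by (simp add: n_def)
  qed
  finally have S: "?w L * p ^ (l * l) * \<psi> (2 * card M) \<le> S" .
  have "(1 / 2) ^ (l * l) \<le> p ^ (l * l)" using p by (intro power_mono) auto
  then have qB: "q * B ^ Suc l \<le> p ^ (l * l)" using p(3) by (simp add: q_def)
  have "?w L * \<psi> n \<le> ?w L * ((q * B) ^ Suc l * \<psi> (2 * card M))"
    by (intro mult_left_mono \<psi>n wnn)
  also have "\<dots> = q ^ l * (?w L * (q * B ^ Suc l) * \<psi> (2 * card M))"
    by (simp add: power_mult_distrib mult_ac)
  also have "\<dots> \<le> q ^ l * (?w L * p ^ (l * l) * \<psi> (2 * card M))"
    using q qB by (intro mult_left_mono mult_right_mono \<psi>nn wnn) auto
  also have "\<dots> \<le> q ^ l * S" using q S by (intro mult_left_mono) auto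
  finally have tail: "?w L * \<psi> n \<le> q ^ l * S" .
  \<comment> \<open>For \<open>j < n\<close> the number of layers before the last fully open one
    grows by one; \<open>j = n\<close> is the new summand.\<close>
  have "(\<Sum>j<Suc n. ?w L * mass ?w (Suc n - 1 - j) z * \<psi> j)
      = (\<Sum>j<n. ?w L * mass ?w (Suc (n - 1 - j)) z * \<psi> j) + ?w L * mass ?w 0 z * \<psi> n"
    by (auto simp: Suc_diff_Suc intro!: sum.cong)
  also have "mass ?w 0 z = 1" using z finite_M by (simp add: mass_def of_bool_def)
  also have "(\<Sum>j<n. ?w L * mass ?w (Suc (n - 1 - j)) z * \<psi> j)
      \<le> (\<Sum>j<n. ?w L * ((1 - q ^ l) * mass ?w (n - 1 - j) z) * \<psi> j)"
    using mass_Suc_le[of ?w, OF wnn sum_weight] w0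
    by (intro sum_mono mult_right_mono mult_left_mono \<psi>nn wnn) auto
  also have "\<dots> = (1 - q ^ l) * S" by (simp add: S_def sum_distrib_left mult_ac)
  finally have main: "(\<Sum>j<Suc n. ?w L * mass ?w (Suc n - 1 - j) z * \<psi> j) \<le> S"
    using tail by (simp add: algebra_simps)
  have "kernel ?H ?w (Suc n) z x \<le> q * B * kernel ?H ?w n z x"
    by (intro drop) (simp_all add: n_def)
  also have "\<dots> \<le> 1 * kernel ?H ?w n z x"
  proof (rule mult_right_mono[OF _ knn])
    have "B \<le> B ^ Suc l" using B by (intro self_le_power) auto
    then have "q * B \<le> q * B ^ Suc l" using q by (intro mult_left_mono) auto
    also have "\<dots> \<le> 1" using qB p0 p power_le_one[of p "l * l"] by linarith
    finally show "q * B \<le> 1" .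
  qed
  finally have "kernel ?H ?w (Suc n) z x \<le> kernel ?H ?w n z x" by simp
  with main show ?thesis
    unfolding kernel_last_full[OF x] S_def \<psi>_def by linarith
qed

text \<open>The loop bound with weights at most \<open>1\<close> yields an initial ratio bound
  \<open>B\<close>. Each round of \<open>card M\<close> steps lowers the current bound by
  \<open>\<eta>\<close>, until it is \<open>1\<close>. All constants depend on \<open>p\<close> only
  through the lower bound \<open>\<delta>\<close> on the weights, which holds on the whole
  interval.\<close>

lemma kernel_decreasing_middle_p:
  assumes \<epsilon>: "0 < \<epsilon>" "\<epsilon> \<le> 1 / 2"
  shows "\<exists>N. \<forall>p\<in>{\<epsilon>..1 - \<epsilon>}. \<forall>z. \<forall>x\<in>M.
    kernel (Pow L) (weight p) (Suc N) z x \<le> kernel (Pow L) (weight p) N z x"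
proof -
  define n0 where "n0 = 2 * card M"
  define \<delta> where "\<delta> = \<epsilon> ^ card L"
  define B where "B = real (card (Pow L)) ^ Suc n0"
  \<comment> \<open>The choices give \<open>K * \<delta> = 8 * (B + 1)\<close> and
    \<open>K ^ card M * \<eta> = \<delta> / 4\<close>. Thus \<open>2 / K \<le> \<delta> / 4\<close>,
    and the contraction condition reduces to
    \<open>1 - \<delta> < (1 - \<delta> / 4) * (1 - \<delta> / 4)\<close>.\<close>
  define K where "K = 8 * (B + 1) / \<delta>"
  define \<eta> where "\<eta> = \<delta> / (4 * K ^ card M)"
  \<comment> \<open>The number of rounds that lower the bound from at least \<open>B\<close> to
    \<open>1\<close>; rounding up costs at most one extra \<open>\<eta> \<le> 1\<close>, hence the
    overall bound \<open>B + 1\<close> used for \<open>D0\<close>.\<close>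
  define J where "J = nat \<lceil>(B - 1) / \<eta>\<rceil>"
  have \<delta>: "0 < \<delta>" "\<delta> \<le> 1" using \<epsilon> by (auto simp: \<delta>_def power_le_one)
  have B: "1 \<le> B" unfolding B_def by (rule card_Pow_power_ge_1)
  have K\<delta>: "K * \<delta> = 8 * (B + 1)" using \<delta> by (simp add: K_def)
  have K: "8 \<le> K"
  proof -
    have "8 * \<delta> \<le> K * \<delta>" using K\<delta> B \<delta> by simp
    then show ?thesis using \<delta> by simp
  qed
  have \<eta>: "0 < \<eta>" using \<delta> K by (simp add: \<eta>_def)
  have K\<eta>: "K ^ card M * \<eta> = \<delta> / 4" using K by (simp add: \<eta>_def)
  have J: "B \<le> 1 + J * \<eta>" "1 + J * \<eta> \<le> B + \<eta>"
  proof -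
    define t where "t = (B - 1) / \<eta>"
    have "0 \<le> t" using B \<eta> by (simp add: t_def)
    then have "0 \<le> \<lceil>t\<rceil>" by linarith
    then have "real J = of_int \<lceil>t\<rceil>" by (simp add: J_def t_def)
    then have "t \<le> J" "J \<le> t + 1" by linarith+
    moreover have "B = 1 + t * \<eta>" using \<eta> by (simp add: t_def)
    moreover have "t * \<eta> \<le> J * \<eta>" "J * \<eta> \<le> (t + 1) * \<eta>"
      using calculation \<eta> by (auto intro!: mult_right_mono)
    ultimately show "B \<le> 1 + J * \<eta>" "1 + J * \<eta> \<le> B + \<eta>"
      by (simp_all add: algebra_simps)
  qed
  have "\<eta> \<le> 1"
  proof -
    have "\<eta> \<le> K ^ card M * \<eta>" using K \<eta> by (simp add: one_le_power)
    then show ?thesis using K\<eta> \<delta> by simp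
  qed
  have contr: "1 - \<delta> < (1 - 2 / K) * (1 - \<delta> / 4)"
  proof -
    have "2 / K \<le> \<delta> / 4" using K K\<delta> B by (simp add: field_simps)
    then have "(1 - \<delta> / 4) * (1 - \<delta> / 4) \<le> (1 - 2 / K) * (1 - \<delta> / 4)"
      using \<delta> by (intro mult_right_mono) auto
    moreover have "1 - \<delta> < (1 - \<delta> / 4) * (1 - \<delta> / 4)"
      using \<delta> by (simp add: algebra_simps add_pos_nonneg)
    ultimately show ?thesis by linarith
  qed
  have "kernel (Pow L) (weight p) (Suc (n0 + J * card M)) z x \<le> kernel (Pow L) (weight p) (n0 + J * card M) z x"
    if p: "p \<in> {\<epsilon>..1 - \<epsilon>}" and x: "x \<in> M" for p z x
  proof -
    let ?w = "weight p"
    let ?\<mu> = "\<lambda>n. kernel (Pow L) ?w n z"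
    have p01: "0 < p" "p < 1" using p \<epsilon> by auto
    have wnn: "0 \<le> ?w \<eta>" for \<eta> using weight_pos[OF p01, of \<eta>] by simp
    have wge: "\<delta> \<le> ?w \<eta>" if "\<eta> \<subseteq> L" for \<eta>
      unfolding \<delta>_def using weight_ge[OF \<epsilon>(1) _ _ that] p by auto
    have rows: "(\<Sum>x\<in>A. trans (Pow L) ?w y x) \<le> 1 - \<delta>" if "A \<subseteq> M" for y A
      using sum_trans_le[of ?w A y, OF wnn sum_weight that] wge[of "{}"] by simp
    \<comment> \<open>A state that is reached is the image under some layer \<open>\<sigma>\<close>,
      and idempotence makes \<open>\<sigma>\<close> fix it; so it stays put with probability at
      least the weight of \<open>\<sigma>\<close>.\<close>
    have diag: "\<delta> \<le> trans (Pow L) ?w x x" if x: "x \<in> M" and pos: "0 < ?\<mu> (Suc n) x" for n x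
    proof -
      have "\<exists>y\<in>M. trans (Pow L) ?w y x \<noteq> 0"
      proof (rule ccontr)
        assume "\<not> ?thesis"
        then have "?\<mu> (Suc n) x = 0" unfolding kernel_Suc_right[OF x] by (intro sum.neutral) auto
        then show False using pos by simp
      qed
      then obtain y where y: "trans (Pow L) ?w y x \<noteq> 0" by blast
      have "\<exists>\<sigma>\<in>Pow L. F \<sigma> y = x"
      proof (rule ccontr)
        assume "\<not> ?thesis"
        then have "trans (Pow L) ?w y x = 0" unfolding trans_def by (intro sum.neutral) auto
        then show False using y by contradiction
      qed
      then obtain \<sigma> where \<sigma>: "\<sigma> \<in> Pow L" "F \<sigma> y = x" by blast
      then have \<sigma>x: "F \<sigma> x = x" using idem[of \<sigma> y] x by simp
      have "\<delta> \<le> ?w \<sigma>" using wge \<sigma> by blast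
      also have "\<dots> = ?w \<sigma> * of_bool (F \<sigma> x = x)" by (simp add: \<sigma>x)
      also have "\<dots> \<le> trans (Pow L) ?w x x"
        unfolding trans_def
        by (rule member_le_sum[OF \<sigma>(1)]) (use finite_L wnn in auto)
      finally show ?thesis .
    qed
    have "?\<mu> (Suc (n0 + i * card M)) x \<le> (1 + real (J - i) * \<eta>) * ?\<mu> (n0 + i * card M) x"
      if "x \<in> M" "i \<le> J" for i x
      using that
    proof (induction i arbitrary: x)
      case 0
      have "?\<mu> (Suc n0) x \<le> 1 * real (card (Pow L) ^ Suc n0) * ?\<mu> n0 x"
        using kernel_Suc_le[of "Pow L" x n0 1 ?w z] finite_L p01 0
        by (simp add: n0_def weight_pos weight_le_1 del: kernel.simps(2))
      also have "\<dots> = B * ?\<mu> n0 x" by (simp add: B_def)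
      also have "\<dots> \<le> (1 + J * \<eta>) * ?\<mu> n0 x"
        by (intro mult_right_mono J kernel_nonneg wnn)
      finally show ?case by simp
    next
      case (Suc i)
      have eq: "1 + real (J - i) * \<eta> = 1 + real (J - Suc i) * \<eta> + \<eta>"
        using Suc.prems by (simp add: of_nat_diff algebra_simps)
      have "real (J - i) * \<eta> \<le> J * \<eta>" using \<eta> by (intro mult_right_mono) auto
      then have le: "1 + real (J - Suc i) * \<eta> + \<eta> \<le> B + 1"
        using eq J \<open>\<eta> \<le> 1\<close> by linarith
      have *: "?\<mu> (Suc (n0 + i * card M)) x \<le> (1 + real (J - Suc i) * \<eta> + \<eta>) * ?\<mu> (n0 + i * card M) x"
        if "x \<in> M" for x
        using Suc.IH[OF that] Suc.prems(2) unfolding eq by (simp only: Suc_leD)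
      have "?\<mu> (Suc (n0 + i * card M + card M)) x
          \<le> (1 + real (J - Suc i) * \<eta>) * ?\<mu> (n0 + i * card M + card M) x"
      proof (rule ratio_bound_improves[where M = M and T = "trans (Pow L) ?w" and \<mu> = ?\<mu> and \<delta> = \<delta>
            and c = \<delta> and K = K and ?D0.0 = "B + 1" and \<eta> = \<eta>
            and D = "1 + real (J - Suc i) * \<eta>" and n = "n0 + i * card M" and x = x])
        show "finite M" by (rule finite_M)
        show "(\<Sum>x\<in>A. trans (Pow L) ?w y x) \<le> 1 - \<delta>" if "A \<subseteq> M" for y A by (rule rows[OF that])
        show "?\<mu> (Suc n) x = (\<Sum>y\<in>M. ?\<mu> n y * trans (Pow L) ?w y x)" if "x \<in> M" for n x
          by (rule kernel_Suc_right[OF that])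
        show "\<delta> \<le> trans (Pow L) ?w x x" if "x \<in> M" "0 < ?\<mu> (Suc n) x" for n x by (rule diag[OF that])
        show "0 \<le> trans (Pow L) ?w y x" for y x by (intro trans_nonneg wnn)
        show "0 \<le> ?\<mu> n x" for n x by (intro kernel_nonneg wnn)
        show "2 < K" "2 * (B + 1) < K * \<delta>" "K ^ card M * \<eta> < 1" using K K\<delta> K\<eta> B \<delta> by auto
        show "1 - \<delta> < (1 - 2 / K) * (1 - K ^ card M * \<eta>)" using contr by (simp only: K\<eta>)
      qed (use \<eta> le * Suc.prems in auto)
      then show ?case by (simp add: ac_simps del: kernel.simps(2))
    qed
    from this[OF x, of J] show ?thesis by simp
  qed
  then show ?thesis by blast
qed

theorem kernel_eventually_decreasing:
  "\<exists>N. \<forall>n\<ge>N. \<forall>p\<in>{0<..<1}. \<forall>z\<in>M. \<forall>x\<in>M.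
     kernel (Pow L) (weight p) (Suc n) z x \<le> kernel (Pow L) (weight p) n z x"
proof -
  define l where "l = card L"
  define N1 where "N1 = 2 * card M"
  define N2 where "N2 = 2 * card M + l + 1"
  define B1 where "B1 = real (card (Pow L)) ^ Suc N1"
  \<comment> \<open>The factor \<open>2 ^ (l * l)\<close> compensates the bound
    \<open>(1 / 2) ^ (l * l)\<close> required for large \<open>p\<close>.\<close>
  define B2 where "B2 = (real (card (Pow L)) ^ Suc N2) ^ Suc l * 2 ^ (l * l)"
  have B1: "1 \<le> B1" unfolding B1_def by (rule card_Pow_power_ge_1)
  have B2: "1 \<le> B2"
  proof -
    have "1 * 1 \<le> real (card (Pow L)) ^ (Suc N2 * Suc l) * 2 ^ (l * l)"
      by (intro mult_mono card_Pow_power_ge_1 one_le_power) auto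
    moreover have "B2 = real (card (Pow L)) ^ (Suc N2 * Suc l) * 2 ^ (l * l)"
      by (simp only: B2_def power_mult[of _ "Suc N2" "Suc l"])
    ultimately show ?thesis by simp
  qed
  \<comment> \<open>Small enough for both outer ranges at once, so that the intermediate range is a
    fixed compact interval. The three thresholds are then added up.\<close>
  define \<epsilon> where "\<epsilon> = 1 / (2 * (B1 + B2))"
  have \<epsilon>: "0 < \<epsilon>" "\<epsilon> \<le> 1 / 2" using B1 B2 by (auto simp: \<epsilon>_def field_simps)
  have \<epsilon>B: "\<epsilon> * B1 \<le> 1" "\<epsilon> * B2 \<le> 1" using B1 B2 by (auto simp: \<epsilon>_def field_simps)
  obtain N3 where N3: "\<And>p z x. p \<in> {\<epsilon>..1 - \<epsilon>} \<Longrightarrow> x \<in> M \<Longrightarrow>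
      kernel (Pow L) (weight p) (Suc N3) z x \<le> kernel (Pow L) (weight p) N3 z x"
    using kernel_decreasing_middle_p[OF \<epsilon>] by blast
  have "kernel (Pow L) (weight p) (Suc n) z x \<le> kernel (Pow L) (weight p) n z x"
    if n: "N1 + N2 + N3 \<le> n" and p: "0 < p" "p < 1" and z: "z \<in> M" and x: "x \<in> M" for n p z x
  proof -
    have wnn: "0 \<le> weight p \<eta>" for \<eta> using weight_pos[OF p, of \<eta>] by simp
    consider "p < \<epsilon>" | "p \<in> {\<epsilon>..1 - \<epsilon>}" | "1 - \<epsilon> < p" by fastforce
    then obtain N where "N \<le> n"
      "\<And>x. x \<in> M \<Longrightarrow> kernel (Pow L) (weight p) (Suc N) z x \<le> kernel (Pow L) (weight p) N z x"
    proof cases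
      case 1
      then have "p * B1 \<le> \<epsilon> * B1" using B1 by (intro mult_right_mono) auto
      then have "p * B1 \<le> 1" using \<epsilon>B by linarith
      then show thesis
        using that[of N1] kernel_decreasing_small_p[OF p] n by (simp add: N1_def B1_def del: kernel.simps(2))
    next
      case 2
      then show thesis using that[of N3] N3 n by simp
    next
      case 3
      then have "(1 - p) * B2 \<le> \<epsilon> * B2" using B2 by (intro mult_right_mono) auto
      then have "(1 - p) * B2 \<le> 1" using \<epsilon>B by linarith
      then have *: "(1 - p) * (real (card (Pow L)) ^ Suc N2) ^ Suc l \<le> (1 / 2) ^ (l * l)"
        by (simp add: B2_def power_one_over field_simps)
      have "1 / 2 \<le> p" using 3 \<epsilon> by linarith
      then show thesis
        using that[of N2] kernel_decreasing_large_p[of p z] * p z n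
        by (simp add: N2_def l_def del: kernel.simps(2))
    qed
    then show ?thesis using kernel_decreasing_from[of "weight p", OF wnn _ _ x] by blast
  qed
  then show ?thesis by (intro exI[of _ "N1 + N2 + N3"]) auto
qed

end

subsection \<open>Connectivity in the layered graph\<close>

lemma joined_mono: "F \<subseteq> F' \<Longrightarrow> joined F u v \<Longrightarrow> joined F' u v"
  using mono_rtranclp[of "\<lambda>a b. {a, b} \<in> F" "\<lambda>a b. {a, b} \<in> F'" u v]
  unfolding joined_iff_rtranclp by blast

lemma joined_edge: "{u, v} \<in> F \<Longrightarrow> joined F u v"
  unfolding joined_iff_rtranclp by (rule r_into_rtranclp)

lemma joined_snoc: "joined F u v \<Longrightarrow> {v, w} \<in> F \<Longrightarrow> joined F u w"
  using joined_edge joined_trans by metis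

lemma joined_induct [consumes 1, case_names refl edge]:
  assumes "joined F u v" "P u" "\<And>c d. joined F u c \<Longrightarrow> {c, d} \<in> F \<Longrightarrow> P c \<Longrightarrow> P d"
  shows "P v"
  using assms(1) unfolding joined_iff_rtranclp
  by (induction rule: rtranclp_induct) (use assms(2,3) in \<open>auto simp: joined_iff_rtranclp\<close>)

text \<open>A path uses only finitely many edges. Over a countable edge set this writes connection
  as a countable union of cylinder events, which gives measurability.\<close>

lemma joined_finite_support:
  "joined {e \<in> K. \<omega> e} u v \<longleftrightarrow> (\<exists>T\<in>{T. finite T \<and> T \<subseteq> K}. joined T u v \<and> (\<forall>e\<in>T. \<omega> e))"
proof
  assume "joined {e \<in> K. \<omega> e} u v"
  then have "\<exists>T. T \<subseteq> K \<and> finite T \<and> joined T u v \<and> (\<forall>e\<in>T. \<omega> e)"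
  proof (induction rule: joined_induct)
    case refl
    show ?case by (rule exI[of _ "{}"]) (simp add: joined_refl)
  next
    case (edge c d)
    then obtain T where "T \<subseteq> K" "finite T" "joined T u c" "\<forall>e\<in>T. \<omega> e" by blast
    then show ?case using edge.hyps
      by (intro exI[of _ "insert {c, d} T"])
        (auto intro: joined_snoc joined_mono[OF subset_insertI])
  qed
  then show "\<exists>T\<in>{T. finite T \<and> T \<subseteq> K}. joined T u v \<and> (\<forall>e\<in>T. \<omega> e)" by blast
next
  assume "\<exists>T\<in>{T. finite T \<and> T \<subseteq> K}. joined T u v \<and> (\<forall>e\<in>T. \<omega> e)"
  then show "joined {e \<in> K. \<omega> e} u v" by (auto intro: joined_mono[rotated])
qed

lemma joined_image:
  assumes "inj f"
  shows "joined ((`) f ` F) (f u) (f v) \<longleftrightarrow> joined F u v"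
proof
  assume "joined F u v"
  then show "joined ((`) f ` F) (f u) (f v)"
  proof (induction rule: joined_induct)
    case (edge c d)
    then have "f ` {c, d} \<in> (`) f ` F" by blast
    then show ?case using edge.IH by (auto intro: joined_snoc)
  qed (rule joined_refl)
next
  assume "joined ((`) f ` F) (f u) (f v)"
  \<comment> \<open>The end vertex is replaced by an arbitrary preimage, as the induction runs over
    vertices of the image graph.\<close>
  then have "\<exists>w. f v = f w \<and> joined F u w"
  proof (induction rule: joined_induct)
    case (edge c d)
    then obtain w e where w: "c = f w" "joined F u w" and e: "e \<in> F" "{c, d} = f ` e" by auto
    then obtain w' where "d = f w'" by blast
    then have "f ` {w, w'} = f ` e" using e w by simp
    then have "{w, w'} = e" using inj_image_eq_iff[OF assms] by metis
    then show ?case using w e \<open>d = f w'\<close> by (auto intro: joined_snoc)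
  qed (auto intro: joined_refl)
  then show "joined F u v" using assms by (auto dest: injD)
qed

section \<open>Vertical shifts and the levels of edges\<close>

definition vshift :: "int \<Rightarrow> 'a \<times> int \<Rightarrow> 'a \<times> int" where
  "vshift k = (\<lambda>(u, l). (u, l + k))"

lemma vshift_simp [simp]: "vshift k (u, l) = (u, l + k)"
  by (simp add: vshift_def)

lemma inj_vshift: "inj (vshift k)"
  by (auto simp: inj_def vshift_def)

lemma inj_image_vshift: "inj ((`) (vshift k))"
  using inj_vshift by (simp add: inj_on_def inj_image_eq_iff)

lemma vshift_layer_edges: "(`) (vshift k) ` layer_edges V E n = layer_edges V E (n + k)"
proof -
  have sub: "(`) (vshift k) ` layer_edges V E n \<subseteq> layer_edges V E (n + k)" for k n
  proof
    fix e' assume "e' \<in> (`) (vshift k) ` layer_edges V E n"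
    then obtain e where e: "e \<in> layer_edges V E n" and e': "e' = vshift k ` e" by blast
    from e consider u v where "{u, v} \<in> E" "e = {(u, n), (v, n)}" | u where "u \<in> V" "e = {(u, n - 1), (u, n)}"
      by (auto simp: layer_edges_def horizontal_edges_def vertical_edges_def)
    then show "e' \<in> layer_edges V E (n + k)"
    proof cases
      case 1
      then show ?thesis using e' by (auto simp: layer_edges_def horizontal_edges_def)
    next
      case 2
      then have "e' = {(u, n + k - 1), (u, n + k)}" using e' by (simp add: algebra_simps)
      then show ?thesis using 2 unfolding layer_edges_def vertical_edges_def by blast
    qed
  qed
  have "layer_edges V E (n + k) \<subseteq> (`) (vshift k) ` layer_edges V E n"
  proof
    fix e assume "e \<in> layer_edges V E (n + k)"
    then have "vshift (- k) ` e \<in> layer_edges V E n" using sub[of "- k" "n + k"] by auto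
    moreover have "e = vshift k ` vshift (- k) ` e" by (simp add: image_image vshift_def case_prod_beta)
    ultimately show "e \<in> (`) (vshift k) ` layer_edges V E n" by (rule rev_image_eqI)
  qed
  with sub show ?thesis by blast
qed

lemma vshift_edges_upto: "(`) (vshift k) ` edges_upto V E n = edges_upto V E (n + k)"
proof -
  have "(\<Union>m\<in>{..n}. layer_edges V E (m + k)) = (\<Union>m\<in>{..n + k}. layer_edges V E m)"
  proof (intro equalityI UN_least)
    fix m assume "m \<in> {..n + k}"
    then have "m - k \<in> {..n}" by simp
    then have "layer_edges V E (m - k + k) \<subseteq> (\<Union>m\<in>{..n}. layer_edges V E (m + k))" by blast
    then show "layer_edges V E m \<subseteq> (\<Union>m\<in>{..n}. layer_edges V E (m + k))" by simp
  next
    fix m assume "m \<in> {..n}"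
    then have "m + k \<in> {..n + k}" by simp
    then show "layer_edges V E (m + k) \<subseteq> (\<Union>m\<in>{..n + k}. layer_edges V E m)" by blast
  qed
  then show ?thesis
    by (simp add: edges_upto_def image_UN vshift_layer_edges)
qed

lemma vshift_layered_edges: "(`) (vshift k) ` layered_edges V E = layered_edges V E"
proof -
  have "(\<Union>n. layer_edges V E (n + k)) = (\<Union>n. layer_edges V E n)"
  proof (intro equalityI UN_least)
    fix m
    have "layer_edges V E (m - k + k) \<subseteq> (\<Union>n. layer_edges V E (n + k))" by blast
    then show "layer_edges V E m \<subseteq> (\<Union>n. layer_edges V E (n + k))" by simp
  qed blast
  then show ?thesis by (simp add: layered_edges_def image_UN vshift_layer_edges)
qed

lemma horizontal_iff: "{(u, n), (v, n)} \<in> layer_edges V E n \<longleftrightarrow> {u, v} \<in> E"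
  by (auto simp: layer_edges_def horizontal_edges_def vertical_edges_def doubleton_eq_iff insert_commute)

lemma vertical_iff: "{(u, n - 1), (u, n)} \<in> layer_edges V E n \<longleftrightarrow> u \<in> V"
  by (auto simp: layer_edges_def horizontal_edges_def vertical_edges_def doubleton_eq_iff)

lemma layer_edgeE:
  assumes "{c, d} \<in> layer_edges V E n"
  obtains u v where "c = (u, n)" "d = (v, n)" "{u, v} \<in> E"
  | u where "u \<in> V" "c = (u, n - 1)" "d = (u, n)"
  | u where "u \<in> V" "c = (u, n)" "d = (u, n - 1)"
proof -
  from assms consider u v where "{u, v} \<in> E" "{c, d} = {(u, n), (v, n)}"
    | u where "u \<in> V" "{c, d} = {(u, n - 1), (u, n)}"
    unfolding layer_edges_def horizontal_edges_def vertical_edges_def by blast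
  then show thesis
  proof cases
    case (1 u v)
    moreover have "{v, u} \<in> E" using 1 by (simp add: insert_commute)
    ultimately show thesis using that(1)[of u v] that(1)[of v u] by (auto simp: doubleton_eq_iff)
  next
    case (2 u)
    then show thesis using that(2,3)[of u] by (auto simp: doubleton_eq_iff)
  qed
qed

lemma edges_upto_level: "{c, d} \<in> edges_upto V E n \<Longrightarrow> snd c \<le> n \<and> snd d \<le> n"
  by (auto simp: edges_upto_def elim!: layer_edgeE)

lemma edges_above_level:
  assumes "{c, d} \<in> layered_edges V E - edges_upto V E n"
  shows "n \<le> snd c \<and> n \<le> snd d"
proof -
  obtain m where m: "{c, d} \<in> layer_edges V E m" using assms by (auto simp: layered_edges_def)
  then have "\<not> m \<le> n" using assms by (auto simp: edges_upto_def)
  with m show ?thesis by (auto elim!: layer_edgeE)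
qed

lemma layered_edges_vertices:
  assumes "simple_graph V E" "{c, d} \<in> layered_edges V E"
  shows "fst c \<in> V"
proof -
  have "u \<in> V" if "{u, v} \<in> E" for u v
    using assms(1) that unfolding simple_graph_def by (metis doubleton_eq_iff)
  then show ?thesis using assms(2) by (auto simp: layered_edges_def elim!: layer_edgeE)
qed

lemma edges_upto_Suc: "edges_upto V E (n + 1) = edges_upto V E n \<union> layer_edges V E (n + 1)"
proof -
  have "{..n + 1} = insert (n + 1) {..n}" by auto
  then show ?thesis by (auto simp: edges_upto_def)
qed

section \<open>Patterns as relations and their update by one layer\<close>

definition places :: "'a set \<Rightarrow> 'a option set" where
  "places V = insert None (Some ` V)"

definition place :: "'a \<times> int \<Rightarrow> int \<Rightarrow> 'a option \<Rightarrow> 'a \<times> int" where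
  "place c n a = (case a of None \<Rightarrow> c | Some u \<Rightarrow> (u, n))"

lemma place_simps [simp]: "place c n None = c" "place c n (Some u) = (u, n)"
  by (simp_all add: place_def)

text \<open>Patterns are handled as equivalence relations. The root \<open>c\<close> is a parameter since, by shift
  invariance, passing from layer \<open>n\<close> to \<open>n + 1\<close> amounts to moving the root from \<open>(r, 0)\<close> to \<open>(r, -1)\<close>.\<close>

definition state :: "'a set \<Rightarrow> 'a set set \<Rightarrow> 'a \<times> int \<Rightarrow> int \<Rightarrow> (('a \<times> int) set \<Rightarrow> bool) \<Rightarrow> 'a option rel" where
  "state V E c n \<omega> = {(a, b) \<in> places V \<times> places V. conn_upto V E n \<omega> (place c n a) (place c n b)}"

text \<open>The configuration of layer \<open>n\<close> is transported to layer \<open>0\<close>, so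
  that all layers act on patterns through the same finite set of edges.\<close>

definition layer_config :: "'a set \<Rightarrow> 'a set set \<Rightarrow> int \<Rightarrow> (('a \<times> int) set \<Rightarrow> bool) \<Rightarrow> ('a \<times> int) set set" where
  "layer_config V E n \<omega> = {e \<in> layer_edges V E 0. \<omega> (vshift n ` e)}"

text \<open>The old pattern survives only on the star and on the vertices with an open vertical edge.\<close>

definition link :: "'a set \<Rightarrow> ('a \<times> int) set set \<Rightarrow> 'a option rel \<Rightarrow> 'a option rel" where
  "link V \<eta> R = (R \<union> R\<inverse>) \<inter> (places {u \<in> V. {(u, -1), (u, 0)} \<in> \<eta>} \<times> places {u \<in> V. {(u, -1), (u, 0)} \<in> \<eta>})
     \<union> {(Some u, Some v) | u v. {(u, 0), (v, 0)} \<in> \<eta>}"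

text \<open>Relations that leave \<open>places V\<close> are kept fixed; they count as dead, so the
  chain axioms hold for every relation. The intersection removes the reflexive pairs outside
  \<open>places V\<close> that the closure adds.\<close>

definition update :: "'a set \<Rightarrow> ('a \<times> int) set set \<Rightarrow> 'a option rel \<Rightarrow> 'a option rel" where
  "update V \<eta> R = (if R \<subseteq> places V \<times> places V then (link V \<eta> R)\<^sup>* \<inter> (places V \<times> places V) else R)"

definition star_states :: "'a set \<Rightarrow> 'a option rel set" where
  "star_states V = {R. R \<subseteq> places V \<times> places V \<and> (\<exists>u\<in>V. (Some u, None) \<in> R \<or> (None, Some u) \<in> R)}"

lemma sym_link: "sym (link V \<eta> R)"
  by (auto simp: sym_def link_def insert_commute)

lemma sym_link_rtrancl: "(a, b) \<in> (link V \<eta> R)\<^sup>* \<Longrightarrow> (b, a) \<in> (link V \<eta> R)\<^sup>*"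
  using sym_rtrancl[OF sym_link] by (rule symD)

lemma places_mono: "A \<subseteq> B \<Longrightarrow> places A \<subseteq> places B"
  by (auto simp: places_def)

text \<open>A chain ending at the star must enter it by a link, and such a link can only be
  inherited from \<open>R\<close> through an open vertical edge. Hence a lost star is never
  regained, and a layer without open edges loses it.\<close>

lemma link_star:
  assumes "(a, b) \<in> (link V \<eta> R)\<^sup>*" "a = None \<or> b = None" "a \<noteq> b"
  shows "\<exists>u\<in>V. {(u, -1), (u, 0)} \<in> \<eta> \<and> ((Some u, None) \<in> R \<or> (None, Some u) \<in> R)"
proof -
  have *: ?thesis if "(Some u, None) \<in> link V \<eta> R" for u
    using that by (auto simp: link_def places_def)
  have "\<exists>u. (Some u, None) \<in> link V \<eta> R" if "(a, None) \<in> (link V \<eta> R)\<^sup>*" "a \<noteq> None" for a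
    using that
  proof (induction rule: converse_rtrancl_induct)
    case (step a b)
    then show ?case by (cases b; cases a) auto
  qed simp
  then show ?thesis using assms sym_link_rtrancl[of a b] * by (metis (full_types))
qed

lemma update_absorbing:
  assumes "R \<notin> star_states V"
  shows "update V \<eta> R \<notin> star_states V"
  using assms link_star[of "Some _" None V \<eta> R] link_star[of None "Some _" V \<eta> R]
  by (fastforce simp: update_def star_states_def split: if_splits)

lemma update_kill: "update V {} R \<notin> star_states V"
proof
  assume *: "update V {} R \<in> star_states V"
  then have "R \<subseteq> places V \<times> places V" by (auto simp: update_def star_states_def split: if_splits)
  with * show False
    using link_star[of "Some _" None V "{}" R] link_star[of None "Some _" V "{}" R]
    by (auto simp: update_def star_states_def)
qed

text \<open>Old links between surviving places belong to the updated relation, and the links which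
  the updated relation offers in a second round already lie in the closure. So both rounds generate
  the same closure.\<close>

lemma update_idem: "update V \<eta> (update V \<eta> R) = update V \<eta> R"
proof (cases "R \<subseteq> places V \<times> places V")
  case True
  define R1 where "R1 = (link V \<eta> R)\<^sup>* \<inter> (places V \<times> places V)"
  let ?A = "places {u \<in> V. {(u, -1), (u, 0)} \<in> \<eta>}"
  have A: "?A \<subseteq> places V" by (rule places_mono) auto
  have "link V \<eta> R1 \<subseteq> (link V \<eta> R)\<^sup>*"
    using sym_link_rtrancl[of _ _ V \<eta> R] by (auto simp: R1_def link_def)
  moreover have "link V \<eta> R \<subseteq> link V \<eta> R1"
  proof
    fix x assume x: "x \<in> link V \<eta> R"
    show "x \<in> link V \<eta> R1"
    proof (cases "x \<in> ?A \<times> ?A")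
      case True
      then have "x \<in> R1" using x A by (auto simp: R1_def)
      then show ?thesis using True by (simp add: link_def)
    next
      case False
      then show ?thesis using x by (auto simp: link_def)
    qed
  qed
  ultimately have "(link V \<eta> R1)\<^sup>* = (link V \<eta> R)\<^sup>*"
    by (metis rtrancl_subset rtrancl_idemp rtrancl_mono subset_antisym)
  moreover have "R1 \<subseteq> places V \<times> places V" by (auto simp: R1_def)
  ultimately show ?thesis using True by (simp add: update_def R1_def)
qed (simp add: update_def)

text \<open>Connectedness of the graph joins all vertices horizontally. As all vertical edges are
  open, a single old link to the star survives and attaches the star to them.\<close>

lemma update_full:
  assumes "connected_graph V E" "R \<in> star_states V"
  shows "update V (layer_edges V E 0) R = places V \<times> places V"
proof -
  let ?L = "layer_edges V E 0"
  have hor: "(Some u, Some v) \<in> (link V ?L R)\<^sup>*" if "u \<in> V" "v \<in> V" for u v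
  proof -
    have "joined E u v" using assms(1) that by (auto simp: connected_graph_def)
    then show ?thesis
    proof (induction rule: joined_induct)
      case (edge c d)
      then have "(Some c, Some d) \<in> link V ?L R" by (simp add: link_def horizontal_iff)
      then show ?case using edge.IH by (rule rtrancl_into_rtrancl[rotated])
    qed simp
  qed
  have vert: "{u \<in> V. {(u, -1), (u, 0)} \<in> ?L} = V"
    using vertical_iff[of _ 0 V E] by auto
  obtain u where u: "u \<in> V" "(None, Some u) \<in> link V ?L R"
    using assms(2) unfolding link_def vert by (auto simp: star_states_def places_def)
  have none: "(None, Some v) \<in> (link V ?L R)\<^sup>*" if "v \<in> V" for v
    using u hor[OF u(1) that] by (meson converse_rtrancl_into_rtrancl)
  have "(a, b) \<in> (link V ?L R)\<^sup>*" if "a \<in> places V" "b \<in> places V" for a b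
    using that hor none sym_link_rtrancl[OF none] by (auto simp: places_def)
  then show ?thesis using assms(2) by (auto simp: update_def star_states_def)
qed

text \<open>A path in the larger edge set alternates between stretches in the lower layers and edges
  of layer \<open>n + 1\<close>. It can change sides only along an open vertical edge, so it is
  recorded by a chain of links. The root lies at level at most \<open>n\<close> and hence on the
  lower side.\<close>

lemma state_Suc:
  assumes "snd c \<le> n"
  shows "state V E c (n + 1) \<omega> = update V (layer_config V E (n + 1) \<omega>) (state V E c n \<omega>)"
proof -
  define Lo where "Lo = {e \<in> edges_upto V E n. \<omega> e}"
  define Up where "Up = {e \<in> layer_edges V E (n + 1). \<omega> e}"
  define \<eta> where "\<eta> = layer_config V E (n + 1) \<omega>"
  define R where "R = state V E c n \<omega>"
  let ?A = "{u \<in> V. {(u, -1), (u, 0)} \<in> \<eta>}"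
  let ?S = "(link V \<eta> R)\<^sup>*"
  have joined_eq: "conn_upto V E (n + 1) \<omega> = joined (Lo \<union> Up)"
    unfolding conn_upto_def edges_upto_Suc Lo_def Up_def by (rule arg_cong[of _ _ joined]) auto
  have R: "(a, b) \<in> R \<longleftrightarrow> a \<in> places V \<and> b \<in> places V \<and> joined Lo (place c n a) (place c n b)" for a b
    by (simp add: R_def state_def conn_upto_def Lo_def)
  have in_\<eta>: "e \<in> \<eta> \<longleftrightarrow> e \<in> layer_edges V E 0 \<and> \<omega> (vshift (n + 1) ` e)" for e
    by (simp only: \<eta>_def layer_config_def mem_Collect_eq)
  have in_Up: "e \<in> Up \<longleftrightarrow> e \<in> layer_edges V E (n + 1) \<and> \<omega> e" for e
    by (simp only: Up_def mem_Collect_eq)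
  have "vshift (n + 1) ` {(u, -1), (u, 0)} = {(u, n), (u, n + 1)}" for u :: 'a by simp
  moreover have "{(u, -1), (u, 0)} \<in> layer_edges V E 0 \<longleftrightarrow> u \<in> V" for u
    using vertical_iff[of u 0 V E] by simp
  moreover have "{(u, n), (u, n + 1)} \<in> layer_edges V E (n + 1) \<longleftrightarrow> u \<in> V" for u
    using vertical_iff[of u "n + 1" V E] by simp
  ultimately have vert: "u \<in> ?A \<longleftrightarrow> {(u, n), (u, n + 1)} \<in> Up" for u
    unfolding mem_Collect_eq in_\<eta> in_Up by metis
  have "vshift (n + 1) ` {(u, 0), (v, 0)} = {(u, n + 1), (v, n + 1)}" for u v :: 'a by simp
  then have hor: "{(u, 0), (v, 0)} \<in> \<eta> \<longleftrightarrow> {(u, n + 1), (v, n + 1)} \<in> Up" for u v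
    unfolding in_\<eta> in_Up horizontal_iff by simp
  have AV: "places ?A \<subseteq> places V" by (rule places_mono) auto
  have level: "snd d' \<le> n" if "joined Lo d d'" "snd d \<le> n" for d d'
    using that by (induction rule: joined_induct) (auto simp: Lo_def dest: edges_upto_level)
  have place_level: "snd (place c n a) \<le> n" for a
    using assms by (cases a) auto
  have linkI: "(a, b) \<in> ?S" if "a \<in> places ?A" "b \<in> places ?A" "joined Lo (place c n a) (place c n b)" for a b
    using that AV by (intro r_into_rtrancl) (auto simp: link_def R)
  have "(a, b) \<in> ?S" if a: "a \<in> places V" and b: "b \<in> places V"
    and j: "joined (Lo \<union> Up) (place c (n + 1) a) (place c (n + 1) b)" for a b
  proof -
    \<comment> \<open>The invariant along the path: the current vertex is on top and linked to
      \<open>a\<close>, or it is below and joined there to a place \<open>b\<close> linked to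
      \<open>a\<close>, where \<open>b\<close> is the star or the vertex through which the path last
      descended.\<close>
    define inv where "inv d \<longleftrightarrow> (\<exists>u. d = (u, n + 1) \<and> (a, Some u) \<in> ?S)
        \<or> (\<exists>b\<in>places ?A. (a, b) \<in> ?S \<and> joined Lo (place c n b) d)" for d
    have top: "(a, Some u) \<in> ?S" if "inv (u, n + 1)" for u
      using that level[OF _ place_level, of _ "(u, n + 1)"] unfolding inv_def by auto
    have bottom: "(a, b) \<in> ?S" if inv: "inv (place c n b)" and b: "b \<in> places ?A" for b
    proof -
      have "place c n b \<noteq> (u, n + 1)" for u using place_level[of b] by auto
      then obtain b' where "b' \<in> places ?A" "(a, b') \<in> ?S" "joined Lo (place c n b') (place c n b)"
        using inv unfolding inv_def by blast
      then show ?thesis using linkI[OF _ b] by (meson rtrancl_trans)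
    qed
    have bottomI: "inv d" if "b \<in> places ?A" "(a, b) \<in> ?S" "joined Lo (place c n b) d" for b d
      using that unfolding inv_def by blast
    have topI: "inv (u, n + 1)" if "(a, Some u) \<in> ?S" for u
      using that unfolding inv_def by blast
    have "inv (place c (n + 1) b)"
      using j
    proof (induction rule: joined_induct)
      case refl
      show ?case
      proof (cases a)
        case None
        then show ?thesis by (intro bottomI[of None]) (auto simp: places_def joined_refl)
      next
        case (Some u)
        then show ?thesis using topI[of u] by simp
      qed
    next
      case (edge d d')
      from edge.hyps(2) show ?case
      proof
        assume Lo: "{d, d'} \<in> Lo"
        then have "snd d \<le> n" using edges_upto_level unfolding Lo_def by blast
        then have "d \<noteq> (u, n + 1)" for u by auto
        then obtain b where b: "b \<in> places ?A" "(a, b) \<in> ?S" "joined Lo (place c n b) d"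
          using edge.IH unfolding inv_def by blast
        show ?thesis by (rule bottomI[OF b(1,2) joined_snoc[OF b(3) Lo]])
      next
        assume Up: "{d, d'} \<in> Up"
        then have "{d, d'} \<in> layer_edges V E (n + 1)" by (simp add: Up_def)
        then show ?thesis
        proof (cases rule: layer_edgeE)
          case (1 u v)
          have "inv (u, n + 1)" using edge.IH 1(1) by (simp only:)
          then have "(a, Some u) \<in> ?S" by (rule top)
          moreover have "{(u, 0), (v, 0)} \<in> \<eta>" using Up unfolding 1(1,2) hor .
          then have "(Some u, Some v) \<in> link V \<eta> R" unfolding link_def by blast
          ultimately have "(a, Some v) \<in> ?S" by (rule rtrancl_into_rtrancl)
          then show ?thesis unfolding 1(2) by (rule topI)
        next
          case (2 u)
          then have "u \<in> ?A" using Up unfolding vert by (simp only: add_diff_cancel_right')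
          then have A: "Some u \<in> places ?A" unfolding places_def by blast
          have "inv (place c n (Some u))" using edge.IH 2(2) by simp
          then have "(a, Some u) \<in> ?S" using A by (rule bottom)
          then show ?thesis unfolding 2(3) by (rule topI)
        next
          case (3 u)
          have "{d, d'} = {(u, n), (u, n + 1)}" using 3(2,3) by auto
          then have "u \<in> ?A" using Up unfolding vert by (simp only:)
          then have A: "Some u \<in> places ?A" unfolding places_def by blast
          have "inv (u, n + 1)" using edge.IH 3(2) by (simp only:)
          then have "(a, Some u) \<in> ?S" by (rule top)
          then show ?thesis using A 3(3) by (intro bottomI[of "Some u"]) (simp_all add: joined_refl)
        qed
      qed
    qed
    then show ?thesis
    proof (cases b)
      case None
      then show ?thesis using \<open>inv (place c (n + 1) b)\<close> bottom[of None] by (simp add: places_def)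
    next
      case (Some u)
      then show ?thesis using \<open>inv (place c (n + 1) b)\<close> top[of u] by simp
    qed
  qed
  \<comment> \<open>Conversely, each link is realised by a path: down a vertical edge, through the
    lower layers and up again, or along a horizontal edge. No vertical edge is needed at the
    star.\<close>
  moreover have "joined (Lo \<union> Up) (place c (n + 1) a) (place c (n + 1) b)" if "(a, b) \<in> ?S" for a b
  proof -
    have up: "joined (Lo \<union> Up) (place c n a) (place c (n + 1) a)" if a: "a \<in> places ?A" for a
    proof (cases a)
      case (Some u)
      then have "u \<in> ?A" using a unfolding places_def by blast
      then have "{(u, n), (u, n + 1)} \<in> Lo \<union> Up" unfolding vert by blast
      then show ?thesis unfolding Some place_simps by (rule joined_edge)
    qed (simp add: joined_refl)
    have lo: "joined (Lo \<union> Up) (place c (n + 1) a) (place c (n + 1) b)"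
      if "(a, b) \<in> R" "a \<in> places ?A" "b \<in> places ?A" for a b
    proof -
      have "joined Lo (place c n a) (place c n b)" using that R by simp
      then have "joined (Lo \<union> Up) (place c n a) (place c n b)" by (rule joined_mono[rotated]) simp
      then have "joined (Lo \<union> Up) (place c n a) (place c (n + 1) b)"
        using up[OF that(3)] by (rule joined_trans)
      with joined_sym[OF up[OF that(2)]] show ?thesis by (rule joined_trans)
    qed
    have step: "joined (Lo \<union> Up) (place c (n + 1) a) (place c (n + 1) b)" if ab: "(a, b) \<in> link V \<eta> R" for a b
    proof -
      from ab consider "(a, b) \<in> R" "a \<in> places ?A" "b \<in> places ?A"
        | "(b, a) \<in> R" "a \<in> places ?A" "b \<in> places ?A"
        | u v where "a = Some u" "b = Some v" "{(u, 0), (v, 0)} \<in> \<eta>"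
        unfolding link_def by blast
      then show ?thesis
      proof cases
        case 1
        then show ?thesis by (rule lo)
      next
        case 2
        then show ?thesis using lo[of b a] joined_sym by metis
      next
        case (3 u v)
        then have "{(u, n + 1), (v, n + 1)} \<in> Lo \<union> Up" unfolding hor by blast
        then show ?thesis unfolding 3 place_simps by (rule joined_edge)
      qed
    qed
    show ?thesis
      using that
      by (induction rule: rtrancl_induct) (simp add: joined_refl, metis step joined_trans)
  qed
  ultimately have iff: "joined (Lo \<union> Up) (place c (n + 1) a) (place c (n + 1) b) \<longleftrightarrow> (a, b) \<in> ?S"
    if "a \<in> places V" "b \<in> places V" for a b
    using that by metis
  have "state V E c (n + 1) \<omega> = ?S \<inter> (places V \<times> places V)"
    unfolding state_def joined_eq by (auto simp only: iff)
  moreover have "R \<subseteq> places V \<times> places V" using R by auto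
  ultimately show ?thesis by (simp add: update_def R_def \<eta>_def)
qed

section \<open>Splitting connections at a layer\<close>

definition upper_links :: "'a set \<Rightarrow> 'a set set \<Rightarrow> int \<Rightarrow> (('a \<times> int) set \<Rightarrow> bool) \<Rightarrow> 'a rel" where
  "upper_links V E n \<omega> =
     {(u, v) \<in> V \<times> V. joined {e \<in> layered_edges V E - edges_upto V E n. \<omega> e} (u, n) (v, n)}"

text \<open>An open path can pass between the edges up to layer \<open>n\<close> and those above
  only at vertices of layer \<open>n\<close>. Its successive stretches therefore form a chain in the
  union of the two relations, which depend on disjoint sets of edges.\<close>

lemma conn_iff_state:
  assumes G: "simple_graph V E" and c: "snd c \<le> n" and v: "v \<in> V"
  shows "conn V E \<omega> c (v, n) \<longleftrightarrow>
    (None, Some v) \<in> (state V E c n \<omega> \<union> map_prod Some Some ` upper_links V E n \<omega>)\<^sup>*"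
    (is "_ \<longleftrightarrow> _ \<in> ?S\<^sup>*")
proof -
  define Lo where "Lo = {e \<in> edges_upto V E n. \<omega> e}"
  define Up where "Up = {e \<in> layered_edges V E - edges_upto V E n. \<omega> e}"
  have joined_eq: "conn V E \<omega> = joined (Lo \<union> Up)"
    unfolding conn_def Lo_def Up_def
    by (rule arg_cong[of _ _ joined]) (auto simp: edges_upto_def layered_edges_def)
  have R: "(a, b) \<in> state V E c n \<omega> \<longleftrightarrow> a \<in> places V \<and> b \<in> places V \<and> joined Lo (place c n a) (place c n b)" for a b
    by (simp add: state_def conn_upto_def Lo_def)
  have Q: "(Some u, Some w) \<in> ?S" if "u \<in> V" "w \<in> V" "joined Up (u, n) (w, n)" for u w
    using that by (force simp: upper_links_def Up_def)
  have vertex: "fst d \<in> V" if "{d, d'} \<in> Lo \<union> Up" for d d'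
  proof -
    have "{d, d'} \<in> layered_edges V E"
      using that by (auto simp: Lo_def Up_def edges_upto_def layered_edges_def)
    then show ?thesis by (rule layered_edges_vertices[OF G])
  qed
  have level: "snd d' \<le> n" if "joined Lo d d'" "snd d \<le> n" for d d'
    using that by (induction rule: joined_induct) (auto simp: Lo_def dest: edges_upto_level)
  have level': "n \<le> snd d'" if "joined Up d d'" "n \<le> snd d" for d d'
    using that(1)
  proof (induction rule: joined_induct)
    case (edge d d')
    then have "{d, d'} \<in> layered_edges V E - edges_upto V E n" by (simp add: Up_def)
    then show ?case using edges_above_level by blast
  qed (use that in simp)
  have place_level: "snd (place c n a) \<le> n" for a
    using c by (cases a) auto
  show ?thesis
  proof
    assume j: "conn V E \<omega> c (v, n)"
    \<comment> \<open>For each initial part of the path, \<open>a\<close> is the place where its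
      current stretch began, and the end vertex is joined to it within one side.\<close>
    have "\<exists>a\<in>places V. (None, a) \<in> ?S\<^sup>* \<and>
        (joined Lo (place c n a) d \<or> (\<exists>u. a = Some u \<and> joined Up (u, n) d))"
      if "joined (Lo \<union> Up) c d" for d
      using that
    proof (induction rule: joined_induct)
      case refl
      show ?case by (intro bexI[of _ None]) (auto simp: joined_refl places_def)
    next
      case (edge d d')
      then obtain a where a: "a \<in> places V" "(None, a) \<in> ?S\<^sup>*"
        "joined Lo (place c n a) d \<or> (\<exists>u. a = Some u \<and> joined Up (u, n) d)" by blast
      have dV: "fst d \<in> V" using edge.hyps vertex by blast
      from edge.hyps(2) show ?case
      proof
        assume Lo: "{d, d'} \<in> Lo"
        show ?thesis
        proof (cases "joined Lo (place c n a) d")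
          case True
          then show ?thesis using a Lo by (auto intro: joined_snoc)
        next
          case False
          then obtain u where u: "a = Some u" "joined Up (u, n) d" using a by blast
          have "snd d \<le> n" using Lo edges_upto_level unfolding Lo_def by blast
          then have d: "d = (fst d, n)" using level'[OF u(2)] by (simp add: prod_eq_iff)
          have "(a, Some (fst d)) \<in> ?S" using Q[of u "fst d"] u d dV a by (auto simp: places_def)
          then have "(None, Some (fst d)) \<in> ?S\<^sup>*" using a by (meson rtrancl_into_rtrancl)
          moreover have "joined Lo (fst d, n) d'" using Lo d joined_edge by metis
          ultimately show ?thesis using dV by (intro bexI[of _ "Some (fst d)"]) (auto simp: places_def)
        qed
      next
        assume Up: "{d, d'} \<in> Up"
        show ?thesis
        proof (cases "joined Lo (place c n a) d")
          case True
          have "n \<le> snd d" using Up edges_above_level unfolding Up_def by blast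
          then have d: "d = (fst d, n)" using level[OF True place_level] by (simp add: prod_eq_iff)
          have "joined Lo (place c n a) (place c n (Some (fst d)))" using True d by simp
          then have "(a, Some (fst d)) \<in> ?S" using dV a R[of a "Some (fst d)"] by (simp add: places_def)
          then have "(None, Some (fst d)) \<in> ?S\<^sup>*" using a by (meson rtrancl_into_rtrancl)
          moreover have "joined Up (fst d, n) d'" using Up d joined_edge by metis
          ultimately show ?thesis using dV by (intro bexI[of _ "Some (fst d)"]) (auto simp: places_def)
        next
          case False
          then show ?thesis using a Up by (auto intro: joined_snoc)
        qed
      qed
    qed
    then obtain a where a: "a \<in> places V" "(None, a) \<in> ?S\<^sup>*"
        "joined Lo (place c n a) (v, n) \<or> (\<exists>u. a = Some u \<and> joined Up (u, n) (v, n))"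
      using j joined_eq by metis
    then have "(a, Some v) \<in> ?S"
      using v R[of a "Some v"] Q[of _ v] by (auto simp: places_def)
    then show "(None, Some v) \<in> ?S\<^sup>*" using a by (meson rtrancl_into_rtrancl)
  next
    assume "(None, Some v) \<in> ?S\<^sup>*"
    moreover have "joined (Lo \<union> Up) (place c n a) (place c n b)" if "(a, b) \<in> ?S" for a b
    proof -
      have up: "joined Up (u, n) (w, n)" if "(u, w) \<in> upper_links V E n \<omega>" for u w
        using that by (simp add: upper_links_def Up_def)
      from that have "joined Lo (place c n a) (place c n b) \<or> joined Up (place c n a) (place c n b)"
        using R[of a b] up by auto
      then show ?thesis using joined_mono[of Lo "Lo \<union> Up"] joined_mono[of Up "Lo \<union> Up"] by blast
    qed
    ultimately have "joined (Lo \<union> Up) (place c n None) (place c n (Some v))"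
      by (induction rule: rtrancl_induct) (simp add: joined_refl, metis joined_trans)
    then show "conn V E \<omega> c (v, n)" by (simp add: joined_eq)
  qed
qed

text \<open>Upper links join vertices only, so a chain starting at the star must leave it through
  \<open>R\<close>.\<close>

lemma star_states_if_linked:
  assumes "(None, Some v) \<in> (R \<union> map_prod Some Some ` Q)\<^sup>*" "R \<subseteq> places V \<times> places V"
  shows "R \<in> star_states V"
proof -
  have "\<exists>u. (None, Some u) \<in> R \<union> map_prod Some Some ` Q"
    using assms(1) by (induction "Some v" arbitrary: v rule: rtrancl_induct) (metis option.exhaust)
  then show ?thesis using assms(2) by (auto simp: star_states_def places_def)
qed

subsection \<open>Percolation\<close>

lemma finite_layer_edges:
  assumes "simple_graph V E" "finite V"
  shows "finite (layer_edges V E n)"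
proof -
  have "E \<subseteq> Pow V" using assms(1) by (auto simp: simple_graph_def)
  then have "finite E" using assms(2) finite_subset by blast
  have "horizontal_edges E n \<subseteq> (\<lambda>e. (\<lambda>u. (u, n)) ` e) ` E"
  proof
    fix e assume "e \<in> horizontal_edges E n"
    then obtain u v where uv: "{u, v} \<in> E" "e = {(u, n), (v, n)}"
      by (auto simp only: horizontal_edges_def)
    then have "e = (\<lambda>u. (u, n)) ` {u, v}" by simp
    then show "e \<in> (\<lambda>e. (\<lambda>u. (u, n)) ` e) ` E" using uv(1) by (rule image_eqI)
  qed
  then have "finite (horizontal_edges E n)" using \<open>finite E\<close> finite_surj by blast
  moreover have "vertical_edges V n = (\<lambda>u. {(u, n - 1), (u, n)}) ` V"
    unfolding vertical_edges_def by blast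
  ultimately show ?thesis using assms(2) by (simp add: layer_edges_def)
qed

locale layered_percolation =
  fixes V :: "'a set" and E :: "'a set set" and r :: 'a and p :: real
  assumes simple: "simple_graph V E" and finite_V: "finite V" and conn_G: "connected_graph V E"
    and r: "r \<in> V" and p: "0 \<le> p" "p \<le> 1"
begin

abbreviation "L \<equiv> layer_edges V E 0"
abbreviation "I \<equiv> layered_edges V E"
abbreviation "bern \<equiv> (\<lambda>_ :: ('a \<times> int) set. measure_pmf (bernoulli_pmf p))"
abbreviation "P \<equiv> percolation V E p"

lemma P_eq: "P = Pi\<^sub>M I bern"
  by (simp add: percolation_def)

sublocale prod: product_prob_space bern I
  by unfold_locales

sublocale P: prob_space P
  unfolding P_eq by (rule prob_space_PiM) unfold_locales

lemma finite_places: "finite (places V)"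
  using finite_V by (simp add: places_def)

sublocale chain: absorbing_chain "star_states V" L "update V" "places V \<times> places V"
proof
  have "star_states V \<subseteq> Pow (places V \<times> places V)" unfolding star_states_def by blast
  then show "finite (star_states V)"
    using finite_places by (meson finite_Pow_iff finite_SigmaI finite_subset)
  show "finite L" by (rule finite_layer_edges[OF simple finite_V])
  have "(Some r, None) \<in> places V \<times> places V" using r by (simp add: places_def)
  then show "places V \<times> places V \<in> star_states V" using r unfolding star_states_def by blast
  show "update V \<eta> z \<notin> star_states V" if "z \<notin> star_states V" for z \<eta>
    using that by (rule update_absorbing)
  show "update V \<eta> (update V \<eta> z) = update V \<eta> z" for z \<eta> by (rule update_idem)
  show "update V L z = places V \<times> places V" if "z \<in> star_states V" for z
    using conn_G that by (rule update_full)
  show "update V {} z \<notin> star_states V" for z by (rule update_kill)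
qed

lemma countable_I: "countable I"
  unfolding layered_edges_def
  by (intro countable_UN countableI_type countable_finite finite_layer_edges[OF simple finite_V])

lemma I_nonempty: "I \<noteq> {}"
proof -
  have "{(r, 0 - 1), (r, 0)} \<in> layer_edges V E 0" using r by (simp only: vertical_iff)
  then show ?thesis unfolding layered_edges_def by blast
qed

lemma layer_edges_subset: "layer_edges V E n \<subseteq> I"
  by (auto simp: layered_edges_def)

lemma edges_upto_subset: "edges_upto V E n \<subseteq> I"
  by (auto simp: layered_edges_def edges_upto_def)

section \<open>Measurability and independence\<close>

lemma pred_coordinate:
  assumes "e \<in> J"
  shows "Measurable.pred (Pi\<^sub>M J bern) (\<lambda>\<omega>. \<omega> e)"
proof -
  have "(\<lambda>\<omega>. \<omega> e) \<in> measurable (Pi\<^sub>M J bern) (bern e)"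
    using assms by (rule measurable_component_singleton)
  also have "measurable (Pi\<^sub>M J bern) (bern e) = measurable (Pi\<^sub>M J bern) (count_space UNIV)"
    by (rule measurable_cong_sets) simp_all
  finally show ?thesis .
qed

lemma pred_iff_const: "Measurable.pred M \<phi> \<Longrightarrow> Measurable.pred M (\<lambda>\<omega>. K \<longleftrightarrow> \<phi> \<omega>)"
  by (cases K) (simp_all add: pred_intros_logic(2))

lemma pred_joined:
  assumes "K \<subseteq> J" "J \<subseteq> I"
  shows "Measurable.pred (Pi\<^sub>M J bern) (\<lambda>\<omega>. joined {e \<in> K. \<omega> e} a b)"
  unfolding joined_finite_support[of K] pred_def
proof (rule sets.sets_Collect_countable_Ex')
  have "countable K" by (rule countable_subset[OF _ countable_I]) (use assms in blast)
  then show "countable {T. finite T \<and> T \<subseteq> K}"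
    by (rule countable_Collect_finite_subset)
next
  fix T assume T: "T \<in> {T. finite T \<and> T \<subseteq> K}"
  have "Measurable.pred (Pi\<^sub>M J bern) (\<lambda>\<omega>. joined T a b \<and> (\<forall>e\<in>T. \<omega> e))"
  proof (intro pred_intros_conj1' pred_intros_finite(3))
    show "Measurable.pred (Pi\<^sub>M J bern) (\<lambda>\<omega>. \<omega> e)" if "e \<in> T" for e
      using that T assms by (intro pred_coordinate) blast
  qed (use T in blast)
  then show "{\<omega> \<in> space (Pi\<^sub>M J bern). joined T a b \<and> (\<forall>e\<in>T. \<omega> e)} \<in> sets (Pi\<^sub>M J bern)"
    by (simp only: pred_def)
qed

text \<open>The coordinates are independent under the product measure, and so are their restrictions
  to disjoint edge sets. The hypotheses \<open>dep\<close> express that each event is determined by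
  one of these restrictions.\<close>

lemma prob_indep:
  assumes AB: "A \<inter> B = {}" "A \<subseteq> I" "B \<subseteq> I"
    and "Measurable.pred (Pi\<^sub>M A bern) \<phi>" "Measurable.pred (Pi\<^sub>M B bern) \<psi>"
    and dep: "\<And>\<omega>. \<phi> (restrict \<omega> A) = \<phi> \<omega>" "\<And>\<omega>. \<psi> (restrict \<omega> B) = \<psi> \<omega>"
  shows "\<P>(\<omega> in P. \<phi> \<omega> \<and> \<psi> \<omega>) = \<P>(\<omega> in P. \<phi> \<omega>) * \<P>(\<omega> in P. \<psi> \<omega>)"
proof -
  have rv: "(\<lambda>\<omega>. \<omega> e) \<in> measurable P (bern e)" if "e \<in> I" for e
    using that unfolding P_eq by (rule measurable_component_singleton)
  have "P.indep_vars bern (\<lambda>e \<omega>. \<omega> e) I"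
  proof (subst P.indep_vars_iff_distr_eq_PiM'[OF I_nonempty rv])
    have "distr P (Pi\<^sub>M I bern) (\<lambda>\<omega>. \<lambda>e\<in>I. \<omega> e) = distr P P (\<lambda>\<omega>. \<omega>)"
      unfolding P_eq by (intro distr_cong) (auto simp: space_PiM PiE_def extensional_restrict)
    also have "\<dots> = (\<Pi>\<^sub>M e\<in>I. bern e)" by (simp add: P_eq)
    also have "\<dots> = (\<Pi>\<^sub>M e\<in>I. distr P (bern e) (\<lambda>\<omega>. \<omega> e))"
      unfolding P_eq
      by (intro PiM_cong refl, subst distr_PiM_component)
        (auto intro: prob_space_measure_pmf)
    finally show "distr P (Pi\<^sub>M I bern) (\<lambda>\<omega>. \<lambda>e\<in>I. \<omega> e) = (\<Pi>\<^sub>M e\<in>I. distr P (bern e) (\<lambda>\<omega>. \<omega> e))" .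
  qed
  from P.indep_varD[OF P.indep_var_restrict[OF this AB], of "{x \<in> space (Pi\<^sub>M A bern). \<phi> x}"
      "{x \<in> space (Pi\<^sub>M B bern). \<psi> x}"]
  have "P.prob ((\<lambda>\<omega>. (restrict \<omega> A, restrict \<omega> B)) -` ({x \<in> space (Pi\<^sub>M A bern). \<phi> x} \<times> {x \<in> space (Pi\<^sub>M B bern). \<psi> x}) \<inter> space P)
     = P.prob ((\<lambda>\<omega>. restrict \<omega> A) -` {x \<in> space (Pi\<^sub>M A bern). \<phi> x} \<inter> space P)
      * P.prob ((\<lambda>\<omega>. restrict \<omega> B) -` {x \<in> space (Pi\<^sub>M B bern). \<psi> x} \<inter> space P)"
    using assms(4,5) by (simp add: pred_def)
  moreover have "(\<lambda>\<omega>. restrict \<omega> A) -` {x \<in> space (Pi\<^sub>M A bern). \<phi> x} \<inter> space P = {\<omega> \<in> space P. \<phi> \<omega>}"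
    by (auto simp: dep space_PiM)
  moreover have "(\<lambda>\<omega>. restrict \<omega> B) -` {x \<in> space (Pi\<^sub>M B bern). \<psi> x} \<inter> space P = {\<omega> \<in> space P. \<psi> \<omega>}"
    by (auto simp: dep space_PiM)
  moreover have "(\<lambda>\<omega>. (restrict \<omega> A, restrict \<omega> B)) -` ({x \<in> space (Pi\<^sub>M A bern). \<phi> x} \<times> {x \<in> space (Pi\<^sub>M B bern). \<psi> x}) \<inter> space P
      = {\<omega> \<in> space P. \<phi> \<omega> \<and> \<psi> \<omega>}"
    by (auto simp: dep space_PiM)
  ultimately show ?thesis by simp
qed

lemma prob_joint_sum:
  assumes "finite A" "finite B"
    and range: "\<And>\<omega>. X \<omega> \<in> A" "\<And>\<omega>. Y \<omega> \<in> B"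
    and X: "\<And>a. a \<in> A \<Longrightarrow> Measurable.pred P (\<lambda>\<omega>. X \<omega> = a)"
    and Y: "\<And>b. b \<in> B \<Longrightarrow> Measurable.pred P (\<lambda>\<omega>. Y \<omega> = b)"
  shows "\<P>(\<omega> in P. \<phi> (X \<omega>) (Y \<omega>))
    = (\<Sum>a\<in>A. \<Sum>b\<in>B. of_bool (\<phi> a b) * \<P>(\<omega> in P. X \<omega> = a \<and> Y \<omega> = b))"
proof -
  let ?Z = "{z \<in> A \<times> B. \<phi> (fst z) (snd z)}"
  have eq: "{\<omega> \<in> space P. \<phi> (X \<omega>) (Y \<omega>)} = (\<Union>z\<in>?Z. {\<omega> \<in> space P. X \<omega> = fst z \<and> Y \<omega> = snd z})"
    using range by auto
  have "\<P>(\<omega> in P. \<phi> (X \<omega>) (Y \<omega>)) = (\<Sum>z\<in>?Z. \<P>(\<omega> in P. X \<omega> = fst z \<and> Y \<omega> = snd z))"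
    unfolding eq
  proof (rule P.finite_measure_finite_Union)
    show "finite ?Z" using assms by simp
    have "{\<omega> \<in> space P. X \<omega> = a \<and> Y \<omega> = b} \<in> sets P" if "a \<in> A" "b \<in> B" for a b
      using X[OF that(1)] Y[OF that(2)] by measurable
    then show "(\<lambda>z. {\<omega> \<in> space P. X \<omega> = fst z \<and> Y \<omega> = snd z}) ` ?Z \<subseteq> sets P" by auto
  qed (auto simp: disjoint_family_on_def)
  also have "\<dots> = (\<Sum>z\<in>A \<times> B. of_bool (\<phi> (fst z) (snd z)) * \<P>(\<omega> in P. X \<omega> = fst z \<and> Y \<omega> = snd z))"
    using assms by (intro sum.mono_neutral_cong_left) auto
  also have "\<dots> = (\<Sum>a\<in>A. \<Sum>b\<in>B. of_bool (\<phi> a b) * \<P>(\<omega> in P. X \<omega> = a \<and> Y \<omega> = b))"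
    by (simp add: sum.cartesian_product case_prod_beta)
  finally show ?thesis .
qed

lemma Collect_restrict: "K \<subseteq> J \<Longrightarrow> {e \<in> K. restrict \<omega> J e} = {e \<in> K. \<omega> e}"
  by auto

lemma state_range: "state V E c n \<omega> \<in> Pow (places V \<times> places V)"
  by (auto simp: state_def)

lemma upper_links_range: "upper_links V E n \<omega> \<in> Pow (V \<times> V)"
  by (auto simp: upper_links_def)

lemma layer_config_range: "layer_config V E n \<omega> \<in> Pow L"
  by (auto simp: layer_config_def)

lemma pred_state:
  assumes "edges_upto V E n \<subseteq> J" "J \<subseteq> I"
  shows "Measurable.pred (Pi\<^sub>M J bern) (\<lambda>\<omega>. state V E c n \<omega> = R)"
proof -
  have "state V E c n \<omega> = R \<longleftrightarrow> R \<subseteq> places V \<times> places V \<and>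
      (\<forall>a\<in>places V. \<forall>b\<in>places V. (a, b) \<in> R \<longleftrightarrow> joined {e \<in> edges_upto V E n. \<omega> e} (place c n a) (place c n b))" for \<omega>
    by (auto simp: state_def conn_upto_def)
  then show ?thesis
    using finite_places
    by (simp only:) (intro pred_intros_conj1' pred_intros_finite(3) pred_iff_const pred_joined assms)
qed

lemma state_restrict: "state V E c n (restrict \<omega> (edges_upto V E n)) = state V E c n \<omega>"
  unfolding state_def conn_upto_def Collect_restrict[OF subset_refl] ..

lemma pred_upper_links:
  assumes "I - edges_upto V E n \<subseteq> J" "J \<subseteq> I"
  shows "Measurable.pred (Pi\<^sub>M J bern) (\<lambda>\<omega>. upper_links V E n \<omega> = Q)"
proof -
  have "upper_links V E n \<omega> = Q \<longleftrightarrow> Q \<subseteq> V \<times> V \<and>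
      (\<forall>u\<in>V. \<forall>v\<in>V. (u, v) \<in> Q \<longleftrightarrow> joined {e \<in> I - edges_upto V E n. \<omega> e} (u, n) (v, n))" for \<omega>
    by (auto simp: upper_links_def)
  then show ?thesis
    using finite_V
    by (simp only:) (intro pred_intros_conj1' pred_intros_finite(3) pred_iff_const pred_joined assms)
qed

lemma upper_links_restrict:
  "upper_links V E n (restrict \<omega> (I - edges_upto V E n)) = upper_links V E n \<omega>"
  unfolding upper_links_def Collect_restrict[OF subset_refl] ..

lemma vshift_in_layer: "e \<in> L \<Longrightarrow> vshift n ` e \<in> layer_edges V E n"
  using vshift_layer_edges[of n V E 0] by auto

lemma pred_layer_config:
  assumes "layer_edges V E n \<subseteq> J" "J \<subseteq> I"
  shows "Measurable.pred (Pi\<^sub>M J bern) (\<lambda>\<omega>. layer_config V E n \<omega> = \<eta>)"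
proof -
  have "layer_config V E n \<omega> = \<eta> \<longleftrightarrow> \<eta> \<subseteq> L \<and> (\<forall>e\<in>L. e \<in> \<eta> \<longleftrightarrow> \<omega> (vshift n ` e))" for \<omega>
    by (auto simp: layer_config_def)
  moreover have "Measurable.pred (Pi\<^sub>M J bern) (\<lambda>\<omega>. \<omega> (vshift n ` e))" if "e \<in> L" for e
    using that assms vshift_in_layer by (intro pred_coordinate) auto
  ultimately show ?thesis
    using chain.finite_L
    by (simp only:) (intro pred_intros_conj1' pred_intros_finite(3) pred_iff_const)
qed

lemma layer_config_restrict: "layer_config V E n (restrict \<omega> (layer_edges V E n)) = layer_config V E n \<omega>"
  using vshift_in_layer by (auto simp: layer_config_def)

section \<open>Transition probabilities of the pattern chain\<close>

lemma prob_layer_config: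
  assumes "\<eta> \<subseteq> L"
  shows "\<P>(\<omega> in P. layer_config V E n \<omega> = \<eta>) = chain.weight p \<eta>"
proof -
  let ?s = "\<lambda>e. vshift n ` e"
  have inj: "inj_on ?s L" using inj_image_vshift inj_on_subset by blast
  have mem: "vshift n ` e \<in> ?s ` \<eta> \<longleftrightarrow> e \<in> \<eta>" for e
    by (rule inj_image_mem_iff[OF inj_image_vshift])
  have "layer_config V E n \<omega> = \<eta> \<longleftrightarrow> (\<forall>e\<in>L. \<omega> (vshift n ` e) \<longleftrightarrow> e \<in> \<eta>)" for \<omega>
    using assms unfolding layer_config_def by blast
  then have "{\<omega> \<in> space P. layer_config V E n \<omega> = \<eta>}
      = {\<omega> \<in> space P. \<forall>e\<in>?s ` L. \<omega> e \<in> {e \<in> ?s ` \<eta>}}"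
    by (simp add: mem)
  also have "emeasure P \<dots> = (\<Prod>e\<in>?s ` L. emeasure (bern e) {e \<in> ?s ` \<eta>})"
    unfolding P_eq
    using finite_layer_edges[OF simple finite_V, of n] vshift_layer_edges[of n V E 0] layer_edges_subset[of n]
    by (intro prod.emeasure_PiM_Collect) auto
  also have "\<dots> = (\<Prod>e\<in>L. emeasure (bern e) {e \<in> \<eta>})"
    using inj by (subst prod.reindex) (simp_all add: mem)
  also have "\<dots> = (\<Prod>e\<in>L. ennreal (if e \<in> \<eta> then p else 1 - p))"
    using p by (intro prod.cong refl) (auto simp: emeasure_pmf_single)
  also have "\<dots> = ennreal (\<Prod>e\<in>L. if e \<in> \<eta> then p else 1 - p)"
    using p by (intro prod_ennreal) auto
  also have "(\<Prod>e\<in>L. if e \<in> \<eta> then p else 1 - p) = chain.weight p \<eta>"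
    using assms chain.finite_L
    by (simp add: prod.If_cases chain.weight_def Int_absorb1 Diff_eq)
  finally show ?thesis
    using p by (simp add: P.emeasure_eq_measure chain.weight_def)
qed

text \<open>This is the Markov property: the new state is a function of the old state and of the
  next layer, which use disjoint edge sets. States without the star drop out because they never lead
  to \<open>x\<close>.\<close>

lemma prob_state_Suc:
  assumes c: "snd c \<le> n" and x: "x \<in> star_states V"
  shows "\<P>(\<omega> in P. state V E c (n + 1) \<omega> = x)
    = (\<Sum>y\<in>star_states V. \<P>(\<omega> in P. state V E c n \<omega> = y) * chain.trans (Pow L) (chain.weight p) y x)"
proof -
  have disj: "edges_upto V E n \<inter> layer_edges V E (n + 1) = {}"
  proof -
    have "False" if "e \<in> edges_upto V E n" "e \<in> layer_edges V E (n + 1)" for e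
    proof -
      from that(2) obtain d d' where "e = {d, d'}" "snd d' = n + 1"
        by (auto simp: layer_edges_def horizontal_edges_def vertical_edges_def)
      then show False using that(1) edges_upto_level[of d d' V E n] by simp
    qed
    then show ?thesis by blast
  qed
  have pX: "Measurable.pred P (\<lambda>\<omega>. state V E c n \<omega> = R)" for R
    unfolding P_eq by (rule pred_state[OF edges_upto_subset subset_refl])
  have pY: "Measurable.pred P (\<lambda>\<omega>. layer_config V E (n + 1) \<omega> = \<eta>)" for \<eta>
    unfolding P_eq by (rule pred_layer_config[OF layer_edges_subset subset_refl])
  have indep: "\<P>(\<omega> in P. state V E c n \<omega> = R \<and> layer_config V E (n + 1) \<omega> = \<eta>)
      = \<P>(\<omega> in P. state V E c n \<omega> = R) * chain.weight p \<eta>" if "\<eta> \<subseteq> L" for R \<eta>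
    unfolding prob_layer_config[OF that, of "n + 1", symmetric]
    by (rule prob_indep[OF disj edges_upto_subset layer_edges_subset pred_state pred_layer_config])
      (simp_all add: edges_upto_subset layer_edges_subset state_restrict layer_config_restrict)
  have "\<P>(\<omega> in P. state V E c (n + 1) \<omega> = x)
      = \<P>(\<omega> in P. update V (layer_config V E (n + 1) \<omega>) (state V E c n \<omega>) = x)"
    by (simp only: state_Suc[OF c])
  also have "\<dots> = (\<Sum>R\<in>Pow (places V \<times> places V). \<Sum>\<eta>\<in>Pow L. of_bool (update V \<eta> R = x) *
       \<P>(\<omega> in P. state V E c n \<omega> = R \<and> layer_config V E (n + 1) \<omega> = \<eta>))"
    using finite_places chain.finite_L state_range layer_config_range pX pY
    by (intro prob_joint_sum[where \<phi> = "\<lambda>R \<eta>. update V \<eta> R = x"]) auto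
  also have "\<dots> = (\<Sum>R\<in>Pow (places V \<times> places V). \<P>(\<omega> in P. state V E c n \<omega> = R) *
      chain.trans (Pow L) (chain.weight p) R x)"
    unfolding chain.trans_def sum_distrib_left
    by (intro sum.cong refl) (simp add: indep)
  also have "\<dots> = (\<Sum>R\<in>star_states V. \<P>(\<omega> in P. state V E c n \<omega> = R) *
      chain.trans (Pow L) (chain.weight p) R x)"
  proof (rule sum.mono_neutral_right)
    show "\<forall>R\<in>Pow (places V \<times> places V) - star_states V.
        \<P>(\<omega> in P. state V E c n \<omega> = R) * chain.trans (Pow L) (chain.weight p) R x = 0"
    proof
      fix R assume "R \<in> Pow (places V \<times> places V) - star_states V"
      then have "update V \<eta> R \<noteq> x" for \<eta> using x update_absorbing by blast
      then show "\<P>(\<omega> in P. state V E c n \<omega> = R) * chain.trans (Pow L) (chain.weight p) R x = 0"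
        by (simp add: chain.trans_def)
    qed
  qed (use finite_places in \<open>auto simp: star_states_def\<close>)
  finally show ?thesis .
qed

lemma prob_state:
  "x \<in> star_states V \<Longrightarrow> \<P>(\<omega> in P. state V E (r, 0) (int k) \<omega> = x)
    = (\<Sum>z\<in>star_states V. \<P>(\<omega> in P. state V E (r, 0) 0 \<omega> = z) * chain.kernel (Pow L) (chain.weight p) k z x)"
proof (induction k arbitrary: x)
  case 0
  then show ?case using chain.finite_M by (simp add: of_bool_def if_distrib cong: if_cong)
next
  case (Suc k)
  have "\<P>(\<omega> in P. state V E (r, 0) (int (Suc k)) \<omega> = x)
      = (\<Sum>y\<in>star_states V. \<P>(\<omega> in P. state V E (r, 0) (int k) \<omega> = y) * chain.trans (Pow L) (chain.weight p) y x)"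
    using prob_state_Suc[of "(r, 0)" "int k" x] Suc.prems by (simp add: add.commute)
  also have "\<dots> = (\<Sum>y\<in>star_states V. \<Sum>z\<in>star_states V. \<P>(\<omega> in P. state V E (r, 0) 0 \<omega> = z) *
      (chain.kernel (Pow L) (chain.weight p) k z y * chain.trans (Pow L) (chain.weight p) y x))"
    by (intro sum.cong refl) (simp add: Suc.IH sum_distrib_right mult.assoc)
  also have "\<dots> = (\<Sum>z\<in>star_states V. \<P>(\<omega> in P. state V E (r, 0) 0 \<omega> = z) *
      chain.kernel (Pow L) (chain.weight p) (Suc k) z x)"
    by (subst sum.swap) (simp only: sum_distrib_left chain.kernel_Suc_right[OF Suc.prems])
  finally show ?case .
qed

text \<open>By \<open>conn_iff_state\<close> and independence, the connection probability is a
  nonnegative combination of the state probabilities. The root \<open>c\<close> enters only through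
  these, so different roots can be compared term by term.\<close>

lemma prob_conn:
  assumes c: "snd c \<le> n" and v: "v \<in> V"
  shows "\<P>(\<omega> in P. conn V E \<omega> c (v, n)) =
    (\<Sum>R\<in>star_states V. \<Sum>Q\<in>Pow (V \<times> V). of_bool ((None, Some v) \<in> (R \<union> map_prod Some Some ` Q)\<^sup>*) *
       (\<P>(\<omega> in P. state V E c n \<omega> = R) * \<P>(\<omega> in P. upper_links V E n \<omega> = Q)))"
proof -
  let ?\<phi> = "\<lambda>R Q. (None, Some v) \<in> (R \<union> map_prod Some Some ` Q)\<^sup>*"
  have pX: "Measurable.pred P (\<lambda>\<omega>. state V E c n \<omega> = R)" for R
    unfolding P_eq by (rule pred_state[OF edges_upto_subset subset_refl])
  have pY: "Measurable.pred P (\<lambda>\<omega>. upper_links V E n \<omega> = Q)" for Q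
    unfolding P_eq by (rule pred_upper_links[OF Diff_subset subset_refl])
  have indep: "\<P>(\<omega> in P. state V E c n \<omega> = R \<and> upper_links V E n \<omega> = Q)
      = \<P>(\<omega> in P. state V E c n \<omega> = R) * \<P>(\<omega> in P. upper_links V E n \<omega> = Q)" for R Q
    by (rule prob_indep[OF _ edges_upto_subset Diff_subset pred_state pred_upper_links])
      (auto simp: edges_upto_subset[THEN subsetD] state_restrict upper_links_restrict)
  have "\<P>(\<omega> in P. conn V E \<omega> c (v, n)) = \<P>(\<omega> in P. ?\<phi> (state V E c n \<omega>) (upper_links V E n \<omega>))"
    by (simp only: conn_iff_state[OF simple c v])
  also have "\<dots> = (\<Sum>R\<in>Pow (places V \<times> places V). \<Sum>Q\<in>Pow (V \<times> V). of_bool (?\<phi> R Q) *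
      \<P>(\<omega> in P. state V E c n \<omega> = R \<and> upper_links V E n \<omega> = Q))"
    using finite_places finite_V state_range upper_links_range pX pY
    by (intro prob_joint_sum) auto
  also have "\<dots> = (\<Sum>R\<in>Pow (places V \<times> places V). \<Sum>Q\<in>Pow (V \<times> V). of_bool (?\<phi> R Q) *
      (\<P>(\<omega> in P. state V E c n \<omega> = R) * \<P>(\<omega> in P. upper_links V E n \<omega> = Q)))"
    by (simp only: indep)
  also have "\<dots> = (\<Sum>R\<in>star_states V. \<Sum>Q\<in>Pow (V \<times> V). of_bool (?\<phi> R Q) *
      (\<P>(\<omega> in P. state V E c n \<omega> = R) * \<P>(\<omega> in P. upper_links V E n \<omega> = Q)))"
  proof (rule sum.mono_neutral_right)
    show "\<forall>R\<in>Pow (places V \<times> places V) - star_states V. (\<Sum>Q\<in>Pow (V \<times> V). of_bool (?\<phi> R Q) *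
      (\<P>(\<omega> in P. state V E c n \<omega> = R) * \<P>(\<omega> in P. upper_links V E n \<omega> = Q))) = 0"
    proof
      fix R assume "R \<in> Pow (places V \<times> places V) - star_states V"
      then have "\<not> ?\<phi> R Q" for Q using star_states_if_linked[of v R Q V] by blast
      then show "(\<Sum>Q\<in>Pow (V \<times> V). of_bool (?\<phi> R Q) *
        (\<P>(\<omega> in P. state V E c n \<omega> = R) * \<P>(\<omega> in P. upper_links V E n \<omega> = Q))) = 0" by simp
    qed
  qed (use finite_places in \<open>auto simp: star_states_def\<close>)
  finally show ?thesis .
qed

lemma pred_conn: "Measurable.pred P (\<lambda>\<omega>. conn V E \<omega> a b)"
  unfolding P_eq conn_def by (rule pred_joined) simp_all

section \<open>Shift invariance and comparison of connection probabilities\<close>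

definition pull :: "int \<Rightarrow> (('a \<times> int) set \<Rightarrow> bool) \<Rightarrow> ('a \<times> int) set \<Rightarrow> bool" where
  "pull k \<omega> = (\<lambda>e\<in>I. \<omega> (vshift k ` e))"

lemma vshift_I: "e \<in> I \<Longrightarrow> vshift k ` e \<in> I"
  using vshift_layered_edges[of k V E] by blast

lemma prob_pull:
  assumes "Measurable.pred P \<phi>"
  shows "\<P>(\<omega> in P. \<phi> (pull k \<omega>)) = \<P>(\<omega> in P. \<phi> \<omega>)"
proof -
  have meas: "pull k \<in> measurable P P"
    unfolding pull_def P_eq
    by (intro measurable_restrict measurable_component_singleton vshift_I)
  have "distr P P (pull k) = P"
    unfolding pull_def P_eq
    using distr_PiM_reindex[of I bern "(`) (vshift k)" I] inj_on_subset[OF inj_image_vshift, of I k] vshift_I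
    by (auto intro: prob_space_measure_pmf)
  then have "\<P>(\<omega> in P. \<phi> \<omega>) = measure (distr P P (pull k)) {\<omega> \<in> space P. \<phi> \<omega>}" by simp
  also have "\<dots> = measure P (pull k -` {\<omega> \<in> space P. \<phi> \<omega>} \<inter> space P)"
    using assms by (intro measure_distr meas) (simp add: pred_def)
  also have "pull k -` {\<omega> \<in> space P. \<phi> \<omega>} \<inter> space P = {\<omega> \<in> space P. \<phi> (pull k \<omega>)}"
    using measurable_space[OF meas] by auto
  finally show ?thesis by simp
qed

lemma joined_pull:
  assumes "K \<subseteq> I"
  shows "joined {e \<in> K. pull k \<omega> e} a b
    \<longleftrightarrow> joined {e \<in> (`) (vshift k) ` K. \<omega> e} (vshift k a) (vshift k b)"
proof -
  have "{e \<in> (`) (vshift k) ` K. \<omega> e} = (`) (vshift k) ` {e \<in> K. pull k \<omega> e}"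
    using assms by (auto simp: pull_def)
  then show ?thesis by (simp only: joined_image[OF inj_vshift])
qed

lemma state_pull: "state V E c n (pull k \<omega>) = state V E (vshift k c) (n + k) \<omega>"
proof -
  have "vshift k (place c n a) = place (vshift k c) (n + k) a" for a by (cases a) simp_all
  then show ?thesis
    unfolding state_def conn_upto_def
    by (simp only: joined_pull[OF edges_upto_subset] vshift_edges_upto)
qed

lemma conn_pull: "conn V E (pull k \<omega>) a b \<longleftrightarrow> conn V E \<omega> (vshift k a) (vshift k b)"
  unfolding conn_def by (simp only: joined_pull[OF subset_refl] vshift_layered_edges)

text \<open>Instead of raising the target layer, the root is lowered to \<open>(r, -1)\<close>. Both
  probabilities are then evaluated at the same layer \<open>n\<close> with the same upper links, and
  only the state probabilities differ.\<close>

lemma prob_conn_decreasing: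
  assumes n: "0 \<le> n" and v: "v \<in> V"
    and le: "\<And>x. x \<in> star_states V \<Longrightarrow>
      \<P>(\<omega> in P. state V E (r, 0) (n + 1) \<omega> = x) \<le> \<P>(\<omega> in P. state V E (r, 0) n \<omega> = x)"
  shows "\<P>(\<omega> in P. conn V E \<omega> (r, 0) (v, n + 1)) \<le> \<P>(\<omega> in P. conn V E \<omega> (r, 0) (v, n))"
proof -
  have "\<P>(\<omega> in P. state V E (r, -1) n \<omega> = x) = \<P>(\<omega> in P. state V E (r, 0) (n + 1) \<omega> = x)" for x
    using prob_pull[of "\<lambda>\<omega>. state V E (r, -1) n \<omega> = x" 1] pred_state[OF edges_upto_subset subset_refl]
    by (simp add: state_pull P_eq)
  then have le': "\<P>(\<omega> in P. state V E (r, -1) n \<omega> = x) \<le> \<P>(\<omega> in P. state V E (r, 0) n \<omega> = x)"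
    if "x \<in> star_states V" for x
    using le[OF that] by simp
  have "\<P>(\<omega> in P. conn V E \<omega> (r, 0) (v, n + 1)) = \<P>(\<omega> in P. conn V E \<omega> (r, -1) (v, n))"
    using prob_pull[of "\<lambda>\<omega>. conn V E \<omega> (r, -1) (v, n)" 1] pred_conn by (simp add: conn_pull)
  also have "\<dots> \<le> \<P>(\<omega> in P. conn V E \<omega> (r, 0) (v, n))"
    using n v by (subst (1 2) prob_conn) (auto intro!: sum_mono mult_left_mono mult_right_mono le')
  finally show ?thesis .
qed

section \<open>The degenerate parameters \<open>p = 0\<close> and \<open>p = 1\<close>, and the
  expected number of connected vertices\<close>

lemma AE_state_of_edges:
  assumes "p = of_bool b"
  shows "AE \<omega> in P. \<forall>e\<in>I. \<omega> e = b"
  unfolding AE_ball_countable[OF countable_I] P_eq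
proof
  fix e assume "e \<in> I"
  have "AE x in bern e. x = b"
    unfolding AE_measure_pmf_iff
  proof
    fix x assume "x \<in> set_pmf (bernoulli_pmf p)"
    then show "x = b" using assms p by (cases x; cases b) (auto simp: set_pmf_iff)
  qed
  then show "AE \<omega> in Pi\<^sub>M I bern. \<omega> e = b"
    by (rule AE_PiM_component[where P = "\<lambda>x. x = b", OF prob_space_measure_pmf \<open>e \<in> I\<close>])
qed

lemma prob_conn_p0:
  assumes "p = 0" "n \<noteq> 0"
  shows "\<P>(\<omega> in P. conn V E \<omega> (r, 0) (v, n)) = 0"
proof -
  have closed: "AE \<omega> in P. \<forall>e\<in>I. \<omega> e = False"
    by (rule AE_state_of_edges) (simp add: assms)
  have "AE \<omega> in P. \<not> conn V E \<omega> (r, 0) (v, n)"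
    using closed
  proof eventually_elim
    case (elim \<omega>)
    then have "{e \<in> I. \<omega> e} = {}" by blast
    moreover have "d = c" if "joined {} c d" for c d :: "'a \<times> int"
      using that by (induction rule: joined_induct) simp_all
    ultimately show ?case using assms(2) unfolding conn_def by (metis snd_conv)
  qed
  then show ?thesis using pred_conn by (subst P.prob_Collect_eq_0) (simp_all add: pred_def)
qed

lemma joined_layered_edges:
  assumes "v \<in> V"
  shows "joined I (r, 0) (v, int k)"
proof -
  have "joined I (r, 0) (r, int k)"
  proof (induction k)
    case (Suc k)
    have "{(r, int (Suc k) - 1), (r, int (Suc k))} \<in> layer_edges V E (int (Suc k))"
      using r by (simp only: vertical_iff)
    then have "{(r, int (Suc k) - 1), (r, int (Suc k))} \<in> I" by (rule subsetD[OF layer_edges_subset])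
    then have "{(r, int k), (r, int (Suc k))} \<in> I" by simp
    with Suc show ?case by (rule joined_snoc)
  qed (simp add: joined_refl)
  moreover have "joined I (r, int k) (v, int k)"
  proof -
    have "joined E r v" using conn_G r assms by (simp add: connected_graph_def)
    then show ?thesis
    proof (induction rule: joined_induct)
      case (edge c d)
      then have "{(c, int k), (d, int k)} \<in> layer_edges V E (int k)" by (simp only: horizontal_iff)
      then have "{(c, int k), (d, int k)} \<in> I" by (rule subsetD[OF layer_edges_subset])
      with edge.IH show ?case by (rule joined_snoc)
    qed (rule joined_refl)
  qed
  ultimately show ?thesis by (rule joined_trans)
qed

lemma prob_conn_p1:
  assumes "p = 1" "v \<in> V"
  shows "\<P>(\<omega> in P. conn V E \<omega> (r, 0) (v, int k)) = 1"
proof -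
  have all_open: "AE \<omega> in P. \<forall>e\<in>I. \<omega> e = True"
    by (rule AE_state_of_edges) (simp add: assms)
  have "AE \<omega> in P. conn V E \<omega> (r, 0) (v, int k)"
    using all_open
  proof eventually_elim
    case (elim \<omega>)
    then have "{e \<in> I. \<omega> e} = I" by blast
    then show ?case using joined_layered_edges[OF assms(2)] by (simp only: conn_def)
  qed
  then show ?thesis using pred_conn by (subst P.prob_Collect_eq_1) (simp_all add: pred_def)
qed

lemma expectation_connected_count:
  "(\<integral>\<omega>. real (connected_count V E r n \<omega>) \<partial>P) = (\<Sum>v\<in>V. \<P>(\<omega> in P. conn V E \<omega> (r, 0) (v, n)))"
proof -
  have count: "real (connected_count V E r n \<omega>) = (\<Sum>v\<in>V. indicat_real {\<omega> \<in> space P. conn V E \<omega> (r, 0) (v, n)} \<omega>)"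
    if "\<omega> \<in> space P" for \<omega>
  proof -
    have "conn V E \<omega> a b \<longleftrightarrow> conn V E \<omega> b a" for a b
      unfolding conn_def by (blast intro: joined_sym)
    then have "{v' \<in> V \<times> {n}. conn V E \<omega> v' (r, 0)} = (\<lambda>v. (v, n)) ` {v \<in> V. conn V E \<omega> (r, 0) (v, n)}"
      by auto
    then have "connected_count V E r n \<omega> = card {v \<in> V. conn V E \<omega> (r, 0) (v, n)}"
      unfolding connected_count_def by (simp add: card_image inj_on_def)
    also have "real \<dots> = (\<Sum>v\<in>V. of_bool (conn V E \<omega> (r, 0) (v, n)))"
      using finite_V by (simp add: of_bool_def sum.If_cases Int_def)
    finally show ?thesis using that by (simp add: indicator_def of_bool_def)
  qed
  have sets: "{\<omega> \<in> space P. conn V E \<omega> (r, 0) (v, n)} \<in> sets P" for v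
    using pred_conn by (simp add: pred_def)
  have "(\<integral>\<omega>. real (connected_count V E r n \<omega>) \<partial>P)
      = (\<integral>\<omega>. (\<Sum>v\<in>V. indicat_real {\<omega> \<in> space P. conn V E \<omega> (r, 0) (v, n)} \<omega>) \<partial>P)"
    by (rule Bochner_Integration.integral_cong[OF refl count])
  also have "\<dots> = (\<Sum>v\<in>V. \<integral>\<omega>. indicat_real {\<omega> \<in> space P. conn V E \<omega> (r, 0) (v, n)} \<omega> \<partial>P)"
    by (intro Bochner_Integration.integral_sum integrable_real_indicator sets)
      (simp add: P.emeasure_eq_measure)
  also have "\<dots> = (\<Sum>v\<in>V. \<P>(\<omega> in P. conn V E \<omega> (r, 0) (v, n)))"
    using sets by (simp add: Int_absorb2 subset_eq)
  finally show ?thesis .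
qed

end

section \<open>From relations back to patterns\<close>

lemma ball_places: "(\<forall>a\<in>places V. \<phi> a) \<longleftrightarrow> \<phi> None \<and> (\<forall>u\<in>V. \<phi> (Some u))"
  by (simp add: places_def)

text \<open>A partition is determined by its relation, and \<open>state\<close> is defined for all
  pairs of places. The pairs not mentioned in \<open>induces_pattern\<close> are covered by symmetry
  and by reflexivity at the star.\<close>

lemma layer_pattern_iff_state:
  assumes "x \<in> patterns V"
  shows "layer_pattern V E r n \<omega> = x \<longleftrightarrow>
    state V E (r, 0) n \<omega> = {(a, b) \<in> places V \<times> places V. pattern_rel x a b}"
proof -
  have comm: "pattern_rel x a b \<longleftrightarrow> pattern_rel x b a" for a b by (auto simp: pattern_rel_def)
  have none: "pattern_rel x None None"
    using assms by (auto simp: pattern_rel_def patterns_def partition_on_def)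
  have comm': "conn_upto V E n \<omega> a b \<longleftrightarrow> conn_upto V E n \<omega> b a" for a b
    unfolding conn_upto_def by (blast intro: joined_sym)
  have none': "conn_upto V E n \<omega> a a" for a
    unfolding conn_upto_def by (rule joined_refl)
  have "state V E (r, 0) n \<omega> = {(a, b) \<in> places V \<times> places V. pattern_rel x a b} \<longleftrightarrow>
      (\<forall>a\<in>places V. \<forall>b\<in>places V.
        conn_upto V E n \<omega> (place (r, 0) n a) (place (r, 0) n b) \<longleftrightarrow> pattern_rel x a b)"
    unfolding state_def by blast
  also have "\<dots> \<longleftrightarrow> induces_pattern V E r n \<omega> x"
  proof -
    have "conn_upto V E n \<omega> (r, 0) (v, n) \<longleftrightarrow> conn_upto V E n \<omega> (v, n) (r, 0)"
      "pattern_rel x None (Some v) \<longleftrightarrow> pattern_rel x (Some v) None" for v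
      by (rule comm' comm)+
    then show ?thesis
      using assms none none'[of "(r, 0)"]
      by (simp only: induces_pattern_def ball_places place_simps) blast
  qed
  finally show ?thesis by (simp only: layer_pattern_eq_iff)
qed

theorem theorem1:
  fixes V :: "'a set" and E :: "'a set set" and r :: 'a
  assumes "simple_graph V E" and "finite V" and "connected_graph V E" and "r \<in> V"
  shows "\<exists>N::int. N \<ge> 0 \<and>
    (\<forall>n\<ge>N. \<forall>p\<in>{0<..<1}. \<forall>x\<in>star_patterns V.
       \<P>(\<omega> in percolation V E p. layer_pattern V E r n \<omega> = x)
         \<ge> \<P>(\<omega> in percolation V E p. layer_pattern V E r (n + 1) \<omega> = x)) \<and>
    (\<forall>n\<ge>N. \<forall>p\<in>{0..1}. \<forall>v\<in>V.
       \<P>(\<omega> in percolation V E p. conn V E \<omega> (r, 0) (v, n))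
         \<ge> \<P>(\<omega> in percolation V E p. conn V E \<omega> (r, 0) (v, n + 1))) \<and>
    (\<forall>n\<ge>N. \<forall>p\<in>{0..1}.
       (\<integral>\<omega>. real (connected_count V E r n \<omega>) \<partial>percolation V E p)
         \<ge> (\<integral>\<omega>. real (connected_count V E r (n + 1) \<omega>) \<partial>percolation V E p))"
proof -
  have perc: "layered_percolation V E r p" if "p \<in> {0..1}" for p
    using assms that by unfold_locales auto
  \<comment> \<open>The kernel and the weight take their parameter as an argument and do not depend
    on the \<open>p\<close> of the locale. Any interpretation thus yields one \<open>N\<close> for
    all \<open>p\<close>; the value \<open>1 / 2\<close> is arbitrary.\<close>
  interpret half: layered_percolation V E r "1 / 2" by (rule perc) simp
  obtain N where N: "\<And>n p z x. N \<le> n \<Longrightarrow> p \<in> {0<..<1} \<Longrightarrow> z \<in> star_states V \<Longrightarrow> x \<in> star_states V \<Longrightarrow>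
      half.chain.kernel (Pow (layer_edges V E 0)) (half.chain.weight p) (Suc n) z x
        \<le> half.chain.kernel (Pow (layer_edges V E 0)) (half.chain.weight p) n z x"
    using half.chain.kernel_eventually_decreasing by blast
  have state: "\<P>(\<omega> in percolation V E p. state V E (r, 0) (n + 1) \<omega> = x)
      \<le> \<P>(\<omega> in percolation V E p. state V E (r, 0) n \<omega> = x)"
    if n: "int N \<le> n" and p01: "p \<in> {0<..<1}" and x: "x \<in> star_states V" for n p x
  proof -
    interpret layered_percolation V E r p using p01 by (intro perc) simp
    define k where "k = nat n"
    have k: "n = int k" "n + 1 = int (Suc k)" "N \<le> k" using n by (simp_all add: k_def)
    show ?thesis
      unfolding k(2) unfolding k(1) prob_state[OF x]
      by (intro sum_mono mult_left_mono measure_nonneg N k(3) p01 x)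
  qed
  have conn: "\<P>(\<omega> in percolation V E p. conn V E \<omega> (r, 0) (v, n + 1))
      \<le> \<P>(\<omega> in percolation V E p. conn V E \<omega> (r, 0) (v, n))"
    if n: "int N \<le> n" and p01: "p \<in> {0..1}" and v: "v \<in> V" for n p v
  proof -
    interpret layered_percolation V E r p using p01 by (rule perc)
    have n0: "0 \<le> n" using n by simp
    \<comment> \<open>At \<open>p = 0\<close> the probability for layer \<open>n + 1\<close>
      vanishes since \<open>n + 1 \<noteq> 0\<close>; at \<open>p = 1\<close> the one for layer
      \<open>n\<close> equals \<open>1\<close>.\<close>
    consider "p = 0" | "p = 1" | "p \<in> {0<..<1}" using p01 by fastforce
    then show ?thesis
    proof cases
      case 1
      then show ?thesis using prob_conn_p0[of "n + 1" v] n0 by simp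
    next
      case 2
      then show ?thesis using prob_conn_p1[OF 2 v, of "nat n"] n0 P.prob_le_1 by simp
    next
      case 3
      then show ?thesis using prob_conn_decreasing[OF n0 v] state[OF n] by blast
    qed
  qed
  have count: "(\<integral>\<omega>. real (connected_count V E r (n + 1) \<omega>) \<partial>percolation V E p)
      \<le> (\<integral>\<omega>. real (connected_count V E r n \<omega>) \<partial>percolation V E p)"
    if n: "int N \<le> n" and p01: "p \<in> {0..1}" for n p
  proof -
    interpret layered_percolation V E r p using p01 by (rule perc)
    show ?thesis unfolding expectation_connected_count by (intro sum_mono conn n p01)
  qed
  have pattern: "\<P>(\<omega> in percolation V E p. layer_pattern V E r (n + 1) \<omega> = x)
      \<le> \<P>(\<omega> in percolation V E p. layer_pattern V E r n \<omega> = x)"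
    if n: "int N \<le> n" and p01: "p \<in> {0<..<1}" and x: "x \<in> star_patterns V" for n p x
  proof -
    have "x \<in> patterns V" using x by (simp add: star_patterns_def)
    moreover have "{(a, b) \<in> places V \<times> places V. pattern_rel x a b} \<in> star_states V"
      using x by (auto simp: star_patterns_def star_states_def places_def)
    ultimately show ?thesis using state[OF n p01] by (simp only: layer_pattern_iff_state)
  qed
  show ?thesis
    by (intro exI[of _ "int N"] conjI ballI allI impI) (simp_all only: of_nat_0_le_iff pattern conn count)
qed

end
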